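(* Let $n\ge 1$, let $L_1,\dots,L_n$ be compact lines, and let $K$ be a closed sublattice of the product $L_1\times\dots\times L_n$, endowed with the subspace topology. Then $C(K)$, endowed with the topology of pointwise convergence on $K$, has the property SLD; that is, for every $\varepsilon>0$ one can write $C(K)=\bigcup_{m\in\mathbb{N}}X_m$ in such a way that for every $m\in\mathbb{N}$ and every $f\in X_m$ there is a set $U\subseteq C(K)$, open in the pointwise topology, such that $f\in U$ and the diameter of $U\cap X_m$ with respect to the supremum norm is less than $\varepsilon$.
   Context: A compact line is a totally ordered set that is compact in its order topology. The product $L_1\times\dots\times L_n$ carries the product topology and the coordinatewise order, with coordinatewise lattice operations $\wedge=\min$ and $\vee=\max$. A sublattice is a nonempty subset closed under $\wedge$ and $\vee$. $C(K)$ is the Banach space of continuous real-valued functions on $K$ with the supremum norm. A compact lattice $K$ as in the claim is called finite-dimensional. SLD (a countable cover by sets of small local norm-diameter) is the property spelled out in the claim. *)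

theory Defs
  imports "HOL-Analysis.Analysis"
begin

text \<open>A totally ordered set is a carrier \<open>A\<close> with a (reflexive) linear order \<open>r\<close> on it. This keeps
  the order topology intrinsic and allows different lines as factors of one product. Having all
  factors of a product inside one type loses no generality: use the disjoint union of the lines.\<close>

text \<open>\<open>A\<close> itself is among the generators because the open rays do not cover a singleton.\<close>

definition line_topology :: "'a set \<Rightarrow> 'a rel \<Rightarrow> 'a topology" where
  "line_topology A r = topology_generated_by
     ({A} \<union> {{x \<in> A. (x, a) \<in> r \<and> x \<noteq> a} |a. a \<in> A} \<union> {{x \<in> A. (a, x) \<in> r \<and> x \<noteq> a} |a. a \<in> A})"

lemma topspace_line_topology [simp]: "topspace (line_topology A r) = A"
  by (auto simp: line_topology_def)

lemma line_topology_linorder: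
  "line_topology (UNIV :: 'a::linorder_topology set) {(x, y). x \<le> y} = euclidean"
proof -
  have eq: "line_topology (UNIV :: 'a set) {(x, y). x \<le> y} =
      topology_generated_by (insert UNIV (range lessThan \<union> range greaterThan))"
    unfolding line_topology_def
    by (rule arg_cong[where f = topology_generated_by])
      (auto simp: image_def lessThan_def greaterThan_def less_le)
  have 1: "open U"
    if "generate_topology_on (insert UNIV (range lessThan \<union> range greaterThan)) U" for U :: "'a set"
    using that by induction auto
  have 2: "generate_topology_on (insert UNIV (range lessThan \<union> range greaterThan)) U"
    if "generate_topology (range lessThan \<union> range greaterThan) U" for U :: "'a set"
    using that by induction (auto intro: generate_topology_on.intros)
  show ?thesis
    unfolding eq topology_eq openin_topology_generated_by_iff open_openin[symmetric]
    using 1 2 open_generated_order by metis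
qed

definition lines_product_topology :: "'i set \<Rightarrow> ('i \<Rightarrow> 'a set) \<Rightarrow> ('i \<Rightarrow> 'a rel) \<Rightarrow> ('i \<Rightarrow> 'a) topology" where
  "lines_product_topology I A r = product_topology (\<lambda>i. line_topology (A i) (r i)) I"

definition compact_line :: "'a set \<Rightarrow> 'a rel \<Rightarrow> bool" where
  "compact_line A r \<longleftrightarrow> linear_order_on A r \<and> compact_space (line_topology A r)"

definition line_min :: "'a rel \<Rightarrow> 'a \<Rightarrow> 'a \<Rightarrow> 'a" where
  "line_min r x y = (if (x, y) \<in> r then x else y)"

definition line_max :: "'a rel \<Rightarrow> 'a \<Rightarrow> 'a \<Rightarrow> 'a" where
  "line_max r x y = (if (x, y) \<in> r then y else x)"

definition prod_sublattice :: "'i set \<Rightarrow> ('i \<Rightarrow> 'a set) \<Rightarrow> ('i \<Rightarrow> 'a rel) \<Rightarrow> ('i \<Rightarrow> 'a) set \<Rightarrow> bool" where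
  "prod_sublattice I A r K \<longleftrightarrow> K \<noteq> {} \<and> K \<subseteq> (\<Pi>\<^sub>E i\<in>I. A i) \<and>
     (\<forall>x\<in>K. \<forall>y\<in>K. (\<lambda>i\<in>I. line_min (r i) (x i) (y i)) \<in> K \<and> (\<lambda>i\<in>I. line_max (r i) (x i) (y i)) \<in> K)"

text \<open>Functions on a topological space \<open>T\<close> are represented by their extensional representatives.\<close>

definition C_space :: "'a topology \<Rightarrow> ('a \<Rightarrow> real) set" where
  "C_space T = {f \<in> extensional (topspace T). continuous_map T euclideanreal f}"

definition pointwise_topology :: "'a topology \<Rightarrow> ('a \<Rightarrow> real) topology" where
  "pointwise_topology T =
     subtopology (product_topology (\<lambda>_. euclideanreal) (topspace T)) (C_space T)"

text \<open>The library's metric of bounded continuous functions; for compact \<open>T\<close> its underlying set is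
  all of \<open>C_space T\<close> and its distance is that of the supremum norm, as the lemmas below confirm.\<close>

abbreviation C_metric :: "'a topology \<Rightarrow> ('a \<Rightarrow> real) metric" where
  "C_metric T \<equiv> cfunspace T euclidean_metric"

lemma mspace_C_metric:
  assumes "compact_space T"
  shows "mspace (C_metric T) = C_space T"
proof -
  have "bounded (f ` topspace T)" if "continuous_map T euclideanreal f" for f
    using image_compactin[OF _ that, of "topspace T"] assms
    by (auto simp: compact_space_def intro: compact_imp_bounded)
  then show ?thesis
    by (auto simp: C_space_def Met_TC.mbounded_alt bounded_two_points Met_TC.fspace_def)
qed

lemma mdist_C_metric:
  assumes "compact_space T" "topspace T \<noteq> {}" "f \<in> C_space T" "g \<in> C_space T"
  shows "mdist (C_metric T) f g = (SUP x\<in>topspace T. \<bar>f x - g x\<bar>)"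
proof -
  have "f \<in> mspace (C_metric T)" "g \<in> mspace (C_metric T)"
    using assms mspace_C_metric by blast+
  then have "f \<in> Met_TC.fspace (topspace T)" "g \<in> Met_TC.fspace (topspace T)"
    using cfunspace_subset_funspace[of T euclidean_metric] by auto
  then show ?thesis
    using assms(2) by (simp add: cfunspace_def Met_TC.fdist_def dist_real_def)
qed

text \<open>Diameters take values in \<open>[0,\<infinity>]\<close>, so that unbounded sets have diameter \<open>\<infinity>\<close>.\<close>

definition mdiam :: "'a metric \<Rightarrow> 'a set \<Rightarrow> ennreal" where
  "mdiam d S = (SUP x\<in>S. SUP y\<in>S. ennreal (mdist d x y))"

definition SLD :: "'a topology \<Rightarrow> 'a metric \<Rightarrow> bool" where
  "SLD X d \<longleftrightarrow> (\<forall>\<epsilon>::real. \<epsilon> > 0 \<longrightarrow> (\<exists>S :: nat \<Rightarrow> 'a set. topspace X = (\<Union>m. S m) \<and>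
     (\<forall>m. \<forall>f \<in> S m. \<exists>U. openin X U \<and> f \<in> U \<and> mdiam d (U \<inter> S m) < ennreal \<epsilon>)))"

lemma topspace_pointwise_topology [simp]: "topspace (pointwise_topology T) = C_space T"
  by (auto simp: pointwise_topology_def C_space_def PiE_UNIV_domain PiE_def)

end

theory Submission
  imports Defs
begin

text \<open>Why the theorem is true. Let \<open>C\<close> be a chain, and let \<open>F x y\<close> depend on \<open>x \<in> C\<close> and on a parameter \<open>y\<close>.
  Consider the supremum of the sums of \<open>\<bar>F x\<^sub>j y\<^sub>j - F x\<^sub>j\<^sub>+\<^sub>1 y\<^sub>j\<bar> - d\<close> over all increasing finite sequences
  of points \<open>x\<^sub>j\<close> and all choices of \<open>y\<^sub>j\<close>. It is finite if finitely many points cut \<open>C\<close> into pieces on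
  which \<open>F\<close> oscillates by at most \<open>d\<close> uniformly in \<open>y\<close>, and it is lower semicontinuous for pointwise
  convergence. Sort the functions according to the multiples of \<open>d\<close> between which this supremum lies.
  Let \<open>G\<close> be in the same class as \<open>F\<close> and agree with \<open>F\<close> up to a small error at the finitely many values
  that occur in a nearly optimal sequence for \<open>F\<close>, refined by the cutting points. If \<open>G\<close> oscillated by
  much more than \<open>d\<close> on a piece on which \<open>F\<close> does not, at whatever parameter, then inserting three points
  into the sequence would raise its value for \<open>G\<close> beyond the class, since the total penalty of the
  insertion is only \<open>3 * d\<close> (lemma \<open>near_maximal_variation_rigid\<close>).

  This is applied to \<open>F x y = f (x \<squnion> y)\<close> in a compact Hausdorff space \<open>X\<close> with a continuous semilattice
  operation, where \<open>x\<close> runs through a closed chain and \<open>y\<close> through \<open>X\<close>; the cutting points exist by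
  compactness (lemma \<open>grid_exists\<close>). Suppose that every point of \<open>X\<close> is a least upper bound of elements
  \<open>c\<^sub>1, \<dots>, c\<^sub>n\<close> of \<open>n\<close> fixed chains. Replacing the \<open>c\<^sub>i\<close> one by one by elements of finite sets moves any
  point to one of finitely many points, while neither \<open>f\<close> nor the functions of its class that are close
  to \<open>f\<close> at finitely many points change by more than a multiple of \<open>n * d\<close>. So closeness at finitely
  many points implies closeness in norm within the class, which is SLD (theorem
  \<open>SLD_if_join_generated_by_chains\<close>).

  A closed sublattice \<open>K\<close> of a product of compact lines is such a space, and the chains come from its
  coordinates: \<open>z \<in> K\<close> is the least upper bound of the elements \<open>c\<^sub>i\<close>, where \<open>c\<^sub>i\<close> is the least element of
  \<open>K\<close> whose \<open>i\<close>-th coordinate is at least that of \<open>z\<close>.\<close>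

section \<open>Penalised variation along a chain\<close>

text \<open>In a list of pairs \<open>(x, y)\<close>, the first components are the points that a path visits, and \<open>y\<close> is the
  parameter at which the step \<^emph>\<open>leaving\<close> \<open>x\<close> is measured. Letting the parameter vary from step to
  step has the effect of measuring each step in the supremum norm over all parameters, while the sum
  still depends on finitely many values of \<open>F\<close> only; this makes its supremum over all lists lower
  semicontinuous in \<open>F\<close> for pointwise convergence. The penalty \<open>d\<close> per step keeps that supremum finite.\<close>

fun variation :: "real \<Rightarrow> ('c \<Rightarrow> 'y \<Rightarrow> real) \<Rightarrow> ('c \<times> 'y) list \<Rightarrow> real" where
  "variation d F ((x, y) # (x', y') # l) = \<bar>F x y - F x' y\<bar> - d + variation d F ((x', y') # l)"
| "variation d F [p] = 0"
| "variation d F [] = 0"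

lemma variation_split:
  "variation d F (us @ p # vs) = variation d F (us @ [p]) + variation d F (p # vs)"
proof (induction us)
  case (Cons q us)
  then show ?case by (cases q; cases p; cases us) auto
qed (cases p; simp)

text \<open>A list has fewer steps than entries, and every step involves two values of the function.\<close>

lemma variation_perturb:
  assumes "fst ` set l \<subseteq> A" "snd ` set l \<subseteq> B"
    and "\<And>x y. x \<in> A \<Longrightarrow> y \<in> B \<Longrightarrow> \<bar>G x y - F x y\<bar> \<le> \<eta>" and "\<eta> \<ge> 0"
  shows "variation d F l - 2 * \<eta> * length l \<le> variation d G l"
  using assms(1,2)
proof (induction l rule: induct_list012)
  case (3 p q l)
  obtain x y x' y' where pq: "p = (x, y)" "q = (x', y')" by fastforce
  have "variation d F (q # l) - 2 * \<eta> * length (q # l) \<le> variation d G (q # l)"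
    using 3 by simp
  moreover have "\<bar>G x y - F x y\<bar> \<le> \<eta>" "\<bar>G x' y - F x' y\<bar> \<le> \<eta>"
    using "3.prems" assms(3) by (auto simp: pq)
  ultimately show ?case by (simp add: pq algebra_simps)
qed (use assms in auto)

lemma sorted_wrt_split_at:
  assumes "sorted_wrt R l" "\<And>p. p \<in> set l \<Longrightarrow> P p \<or> Q p" "\<And>p q. p \<in> set l \<Longrightarrow> q \<in> set l \<Longrightarrow> R p q \<Longrightarrow> Q p \<Longrightarrow> Q q"
  obtains us vs where "l = us @ vs" "\<forall>p\<in>set us. P p" "\<forall>p\<in>set vs. Q p"
proof -
  have "\<exists>us vs. l = us @ vs \<and> (\<forall>p\<in>set us. P p) \<and> (\<forall>p\<in>set vs. Q p)"
    using assms
  proof (induction l)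
    case (Cons p l)
    show ?case
    proof (cases "Q p")
      case True
      then have "\<forall>q\<in>set (p # l). Q q" using Cons.prems by auto
      then show ?thesis by (intro exI[of _ "[]"] exI[of _ "p # l"]) auto
    next
      case False
      then have "P p" using Cons.prems by auto
      moreover have "\<exists>us vs. l = us @ vs \<and> (\<forall>p\<in>set us. P p) \<and> (\<forall>p\<in>set vs. Q p)"
      proof (rule Cons.IH)
        show "sorted_wrt R l" using Cons.prems(1) by simp
        show "P q \<or> Q q" if "q \<in> set l" for q
          using that by (simp add: Cons.prems(2))
        show "Q q'" if "q \<in> set l" "q' \<in> set l" "R q q'" "Q q" for q q'
          using that by (intro Cons.prems(3)[of q q']) auto
      qed
      then obtain us vs where "l = us @ vs \<and> (\<forall>p\<in>set us. P p) \<and> (\<forall>p\<in>set vs. Q p)" by blast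
      ultimately show ?thesis by (intro exI[of _ "p # us"] exI[of _ "vs"]) auto
    qed
  qed auto
  then show ?thesis using that by blast
qed

text \<open>Points \<open>x\<close> run through the chain \<open>C\<close>, parameters \<open>y\<close> through \<open>Y\<close>.\<close>

locale chain_carrier =
  fixes C :: "'c set" and le :: "'c \<Rightarrow> 'c \<Rightarrow> bool" (infix "\<sqsubseteq>" 50) and Y :: "'y set"
  assumes chain_trans: "x \<in> C \<Longrightarrow> y \<in> C \<Longrightarrow> z \<in> C \<Longrightarrow> x \<sqsubseteq> y \<Longrightarrow> y \<sqsubseteq> z \<Longrightarrow> x \<sqsubseteq> z"
    and chain_total: "x \<in> C \<Longrightarrow> y \<in> C \<Longrightarrow> x \<sqsubseteq> y \<or> y \<sqsubseteq> x"
begin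

lemma chain_refl: "x \<in> C \<Longrightarrow> x \<sqsubseteq> x"
  using chain_total by blast

definition track :: "('c \<times> 'y) list \<Rightarrow> bool" where
  "track l \<longleftrightarrow> set l \<subseteq> C \<times> Y \<and> sorted_wrt (\<lambda>p q. fst p \<sqsubseteq> fst q) l"

text \<open>A grid cuts the chain into pieces on which \<open>F\<close> oscillates by at most \<open>d\<close>, uniformly in the parameter.
  In an antisymmetric chain the choice \<open>a = b = z\<close> makes the condition trivial for \<open>z \<in> A\<close>, so a jump of
  \<open>F\<close> between two adjacent points is allowed as long as both of them belong to \<open>A\<close>.\<close>

definition grid :: "('c \<Rightarrow> 'y \<Rightarrow> real) \<Rightarrow> real \<Rightarrow> 'c set \<Rightarrow> bool" where
  "grid F d A \<longleftrightarrow> finite A \<and> A \<subseteq> C \<and>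
     (\<forall>z\<in>C. \<exists>a\<in>A. \<exists>b\<in>A. a \<sqsubseteq> z \<and> z \<sqsubseteq> b \<and>
        (\<forall>x\<in>C. \<forall>x'\<in>C. \<forall>y\<in>Y. a \<sqsubseteq> x \<longrightarrow> x \<sqsubseteq> b \<longrightarrow> a \<sqsubseteq> x' \<longrightarrow> x' \<sqsubseteq> b \<longrightarrow> \<bar>F x y - F x' y\<bar> \<le> d))"

text \<open>Only steps longer than \<open>d\<close> contribute positively, and such a step must leave a piece of the grid
  behind: it passes over the upper end of the piece that contains its starting point.
  Hence the number of grid points that still lie ahead drops at each such step.\<close>

lemma grid_bounds_variation:
  assumes "grid F d A" "d > 0" "B \<ge> 0" and B: "\<And>x x' y. x \<in> C \<Longrightarrow> x' \<in> C \<Longrightarrow> y \<in> Y \<Longrightarrow> \<bar>F x y - F x' y\<bar> \<le> B"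
    and "track l"
  shows "variation d F l \<le> B * card A"
proof -
  have A: "finite A" "A \<subseteq> C" using assms(1) by (auto simp: grid_def)
  define N where "N x = card {a \<in> A. x \<sqsubseteq> a}" for x
  have N: "N x' + (if \<bar>F x y - F x' y\<bar> \<le> d then 0 else 1) \<le> N x"
    if x: "x \<in> C" "x' \<in> C" "x \<sqsubseteq> x'" and y: "y \<in> Y" for x x' y
  proof -
    have 1: "{a \<in> A. x' \<sqsubseteq> a} \<subseteq> {a \<in> A. x \<sqsubseteq> a}"
      using x A chain_trans by blast
    show ?thesis
    proof (cases "\<bar>F x y - F x' y\<bar> \<le> d")
      case True
      then show ?thesis
        using card_mono[OF _ 1] A(1) by (simp add: N_def)
    next
      case False
      obtain a b where ab: "a \<in> A" "b \<in> A" "a \<sqsubseteq> x" "x \<sqsubseteq> b"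
        and osc: "\<And>u. u \<in> C \<Longrightarrow> a \<sqsubseteq> u \<Longrightarrow> u \<sqsubseteq> b \<Longrightarrow> \<bar>F x y - F u y\<bar> \<le> d"
        using assms(1) x y unfolding grid_def by meson
      have nb: "\<not> x' \<sqsubseteq> b" using osc[of x'] False ab x A chain_trans by blast
      have "b \<in> {a \<in> A. x \<sqsubseteq> a} - {a \<in> A. x' \<sqsubseteq> a}" using ab nb by auto
      then have "{a \<in> A. x' \<sqsubseteq> a} \<subset> {a \<in> A. x \<sqsubseteq> a}" using 1 by blast
      then have "card {a \<in> A. x' \<sqsubseteq> a} < card {a \<in> A. x \<sqsubseteq> a}"
        using A(1) by (intro psubset_card_mono) auto
      then show ?thesis using False by (simp add: N_def)
    qed
  qed
  have le: "variation d F l \<le> B * (if l = [] then 0 else real (N (fst (hd l))))"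
    using \<open>track l\<close>
  proof (induction l rule: induct_list012)
    case (3 p q l)
    obtain x y x' y' where pq: "p = (x, y)" "q = (x', y')" by fastforce
    have t: "track (q # l)" "x \<in> C" "x' \<in> C" "x \<sqsubseteq> x'" "y \<in> Y" using "3.prems" by (auto simp: track_def pq)
    have IH: "variation d F (q # l) \<le> B * real (N x')" using 3 t by (simp add: pq)
    have "\<bar>F x y - F x' y\<bar> - d \<le> B * (if \<bar>F x y - F x' y\<bar> \<le> d then 0 else 1)"
      using B[OF t(2,3,5)] assms(2) by auto
    then have "variation d F (p # q # l) \<le> B * ((if \<bar>F x y - F x' y\<bar> \<le> d then 0 else 1) + real (N x'))"
      using IH by (simp add: pq algebra_simps)
    also have "\<dots> \<le> B * real (N x)"
      using N[OF t(2-5)] \<open>B \<ge> 0\<close> by (intro mult_left_mono) (auto split: if_splits)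
    finally show ?case by (simp add: pq)
  qed (use \<open>B \<ge> 0\<close> in auto)
  also have "\<dots> \<le> B * card A"
    using A(1) \<open>B \<ge> 0\<close> by (auto intro!: mult_left_mono card_mono simp: N_def)
  finally show ?thesis .
qed

text \<open>The key computation. A point \<open>z\<close> lying in a piece of the grid of \<open>F\<close> is inserted into a track
  together with a point \<open>a\<close> before and a point \<open>b\<close> after it, both chosen among finitely many points
  that do not depend on \<open>z\<close>. The detour \<open>a, z, b\<close> costs three penalties. The step of the track that it
  interrupts is measured at one parameter \<open>w\<close> occurring in the track; the new steps to \<open>a\<close> and from
  \<open>b\<close> are measured at the same \<open>w\<close>, so what is lost there is at most the difference between \<open>a\<close> and
  \<open>b\<close> at \<open>w\<close>. On the other hand the step from \<open>z\<close> to \<open>b\<close> may be measured at an arbitrary parameter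
  \<open>y\<close>. A second function \<open>G\<close> enters only through its difference between \<open>a\<close> and \<open>b\<close> at the finitely many
  parameters of the track, which pointwise closeness to \<open>F\<close> controls.\<close>

lemma track_insert:
  assumes "track l" "grid F d A" "z \<in> C" "d \<ge> 0"
  obtains a b where "a \<in> A \<union> fst ` set l" "b \<in> A \<union> fst ` set l" "a \<sqsubseteq> z" "z \<sqsubseteq> b"
    "\<And>y. y \<in> Y \<Longrightarrow> \<bar>F a y - F b y\<bar> \<le> d" "\<And>y. y \<in> Y \<Longrightarrow> \<bar>F z y - F b y\<bar> \<le> d"
    "\<And>G y s. y \<in> Y \<Longrightarrow> s \<ge> 0 \<Longrightarrow> (\<And>w. w \<in> snd ` set l \<Longrightarrow> \<bar>G a w - G b w\<bar> \<le> s) \<Longrightarrow>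
       \<exists>l'. track l' \<and> variation d G l' \<ge> variation d G l - 3 * d + \<bar>G z y - G b y\<bar> - s"
proof -
  have A: "finite A" "A \<subseteq> C" using assms(2) by (auto simp: grid_def)
  obtain a0 b0 where ab0: "a0 \<in> A" "b0 \<in> A" "a0 \<sqsubseteq> z" "z \<sqsubseteq> b0"
    and osc: "\<And>x x' y. x \<in> C \<Longrightarrow> x' \<in> C \<Longrightarrow> y \<in> Y \<Longrightarrow> a0 \<sqsubseteq> x \<Longrightarrow> x \<sqsubseteq> b0 \<Longrightarrow> a0 \<sqsubseteq> x' \<Longrightarrow> x' \<sqsubseteq> b0 \<Longrightarrow> \<bar>F x y - F x' y\<bar> \<le> d"
    using assms(2,3) unfolding grid_def by meson
  have l: "set l \<subseteq> C \<times> Y" "sorted_wrt (\<lambda>p q. fst p \<sqsubseteq> fst q) l"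
    using assms(1) by (auto simp: track_def)
  obtain us vs where lv: "l = us @ vs" and us: "\<forall>p\<in>set us. fst p \<sqsubseteq> z" and vs: "\<forall>p\<in>set vs. z \<sqsubseteq> fst p"
  proof (rule sorted_wrt_split_at[OF l(2)])
    show "fst p \<sqsubseteq> z \<or> z \<sqsubseteq> fst p" if "p \<in> set l" for p
      using that l(1) assms(3) chain_total by fastforce
    show "z \<sqsubseteq> fst q" if "p \<in> set l" "q \<in> set l" "fst p \<sqsubseteq> fst q" "z \<sqsubseteq> fst p" for p q
      using that l(1) assms(3) chain_trans[of z "fst p" "fst q"] by fastforce
  qed
  \<comment> \<open>The ends of the grid piece are moved towards \<open>z\<close> if points of the track are in between.\<close>
  obtain a where a: "a \<in> C" "a \<in> A \<union> fst ` set us" "a0 \<sqsubseteq> a" "a \<sqsubseteq> z" "\<forall>p\<in>set us. fst p \<sqsubseteq> a"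
  proof (cases us rule: rev_cases)
    case Nil
    then show ?thesis using that[of a0] ab0 A chain_refl by auto
  next
    case (snoc us0 p)
    then have p: "p \<in> set l" "\<forall>q\<in>set us. fst q \<sqsubseteq> fst p"
      using l chain_refl by (auto simp: lv sorted_wrt_append)
    then have pC: "fst p \<in> C" "\<forall>q\<in>set us. fst q \<in> C" using l(1) by (auto simp: lv)
    show ?thesis
    proof (cases "a0 \<sqsubseteq> fst p")
      case True
      then show ?thesis using that[of "fst p"] p pC us snoc by auto
    next
      case False
      then have "fst p \<sqsubseteq> a0" using chain_total pC ab0 A by blast
      then have "\<forall>q\<in>set us. fst q \<sqsubseteq> a0" using p pC ab0 A chain_trans by blast
      then show ?thesis using that[of a0] ab0 A chain_refl by auto
    qed
  qed
  obtain b where b: "b \<in> C" "b \<in> A \<union> fst ` set vs" "b \<sqsubseteq> b0" "z \<sqsubseteq> b" "\<forall>p\<in>set vs. b \<sqsubseteq> fst p"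
  proof (cases vs)
    case Nil
    then show ?thesis using that[of b0] ab0 A chain_refl by auto
  next
    case (Cons p vs0)
    then have p: "p \<in> set l" "\<forall>q\<in>set vs. fst p \<sqsubseteq> fst q"
      using l chain_refl by (auto simp: lv sorted_wrt_append)
    then have pC: "fst p \<in> C" "\<forall>q\<in>set vs. fst q \<in> C" using l(1) by (auto simp: lv)
    show ?thesis
    proof (cases "fst p \<sqsubseteq> b0")
      case True
      then show ?thesis using that[of "fst p"] p pC vs Cons by auto
    next
      case False
      then have "b0 \<sqsubseteq> fst p" using chain_total pC ab0 A by blast
      then have "\<forall>q\<in>set vs. b0 \<sqsubseteq> fst q" using p pC ab0 A chain_trans by blast
      then show ?thesis using that[of b0] ab0 A chain_refl by auto
    qed
  qed
  have ab: "a \<sqsubseteq> b" using a b assms(3) chain_trans by blast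
  have in_box: "a0 \<sqsubseteq> b" "a \<sqsubseteq> b0" "a0 \<sqsubseteq> z" "z \<sqsubseteq> b0"
    using a b ab0 ab A assms(3) chain_trans by (meson subsetD)+
  have osc_ab: "\<bar>F a y - F b y\<bar> \<le> d" if "y \<in> Y" for y
    using that a b in_box osc by blast
  have osc_zb: "\<bar>F z y - F b y\<bar> \<le> d" if "y \<in> Y" for y
    using that a b in_box osc assms(3) by blast
  have ins: "\<exists>l'. track l' \<and> variation d G l' \<ge> variation d G l - 3 * d + \<bar>G z y - G b y\<bar> - s"
    if y: "y \<in> Y" and s: "s \<ge> 0" "\<And>w. w \<in> snd ` set l \<Longrightarrow> \<bar>G a w - G b w\<bar> \<le> s" for G y s
  proof -
    \<comment> \<open>If nothing precedes \<open>z\<close>, no step is interrupted and any parameter will do.\<close>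
    define w where "w = (if us = [] then y else snd (last us))"
    have w: "w \<in> Y"
    proof (cases "us = []")
      case False
      then have "last us \<in> C \<times> Y" using l(1) last_in_set[of us] by (auto simp: lv)
      then show ?thesis using False by (auto simp: w_def)
    qed (use y in \<open>simp add: w_def\<close>)
    define l' where "l' = us @ (a, y) # (z, y) # (b, w) # vs"
    have "fst q \<sqsubseteq> fst p" if "p \<in> set vs" "q \<in> set us" for p q
      using that l by (auto simp: lv sorted_wrt_append)
    moreover have "fst q \<sqsubseteq> b" if "q \<in> set us" for q
      using that a b ab l(1) chain_trans[of "fst q" a b] by (force simp: lv)
    moreover have "a \<sqsubseteq> fst q" if "q \<in> set vs" for q
      using that a b ab l(1) chain_trans[of a b "fst q"] by (force simp: lv)
    ultimately have "track l'"
      using l a b w y assms(3) ab us vs by (auto simp: track_def l'_def lv sorted_wrt_append)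
    moreover have "variation d G l' \<ge> variation d G l - 3 * d + \<bar>G z y - G b y\<bar> - s"
    proof (cases us rule: rev_cases)
      case Nil
      then show ?thesis using assms(4) s(1)
        by (cases vs) (auto simp: l'_def lv w_def)
    next
      case (snoc us0 p)
      obtain u where p: "p = (u, w)" using snoc by (cases p) (auto simp: w_def)
      have "w \<in> snd ` set l" using snoc p by (force simp: lv)
      then have *: "\<bar>G a w - G b w\<bar> \<le> s" by (rule s(2))
      have "\<bar>G u w - G v w\<bar> \<le> \<bar>G u w - G a w\<bar> + \<bar>G b w - G v w\<bar> + s" for v
        using * by linarith
      note tri = this
      show ?thesis
      proof (cases vs)
        case Nil
        then show ?thesis
          using assms(4) s(1) variation_split[of d G us0 "(u, w)" "[(a, y), (z, y), (b, w)]"]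
          by (simp add: l'_def lv snoc p)
      next
        case (Cons q vs0)
        then obtain v v' where q: "q = (v, v')" by fastforce
        show ?thesis
          using tri[of v] abs_ge_zero[of "G a y - G z y"]
            variation_split[of d G us0 "(u, w)" "(a, y) # (z, y) # (b, w) # vs"]
            variation_split[of d G us0 "(u, w)" vs]
          unfolding l'_def lv snoc p Cons q append.assoc append_Cons append_Nil variation.simps
          by argo
      qed
    qed
    ultimately show ?thesis by blast
  qed
  have "a \<in> A \<union> fst ` set l" "b \<in> A \<union> fst ` set l" using a(2) b(2) by (auto simp: lv)
  then show ?thesis by (rule that) (fact a(4) b(4) osc_ab osc_zb ins)+
qed

text \<open>If \<open>G\<close> oscillated by more than \<open>6 * d\<close> from \<open>z\<close> to \<open>b\<close>, then inserting \<open>z\<close> into the track \<open>l\<close>, which is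
  optimal for \<open>F\<close> up to \<open>d\<close>, would push the variation of \<open>G\<close> above \<open>k * d\<close>. The six units are: one for
  the bin, three penalties, one for the oscillation of \<open>F\<close> between \<open>a\<close> and \<open>b\<close>, and one for the
  pointwise approximation. It is essential that \<open>b\<close> depends on neither \<open>G\<close> nor the parameter.\<close>

lemma near_maximal_variation_rigid:
  assumes "grid F d A" "track l" "d > 0" and k: "(k - 1) * d < variation d F l"
  obtains Q \<eta> E where "finite Q" "Q \<subseteq> C \<times> Y" "\<eta> > 0" "finite E" "E \<subseteq> C"
    "\<forall>z\<in>C. \<exists>b\<in>E. z \<sqsubseteq> b \<and> (\<forall>y\<in>Y. \<bar>F z y - F b y\<bar> \<le> d) \<and>
       (\<forall>G. (\<forall>(x, y)\<in>Q. \<bar>G x y - F x y\<bar> < \<eta>) \<longrightarrow> (\<forall>l. track l \<longrightarrow> variation d G l \<le> k * d) \<longrightarrow>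
            (\<forall>y\<in>Y. \<bar>G z y - G b y\<bar> \<le> 6 * d))"
proof -
  define E where "E = A \<union> fst ` set l"
  \<comment> \<open>Small enough that the variation along \<open>l\<close> and one further difference change by at most \<open>d\<close> in total.\<close>
  define \<eta> where "\<eta> = d / (2 * (length l + 1))"
  have "\<eta> * (2 * (length l + 1)) = d"
    unfolding \<eta>_def by (rule nonzero_eq_divide_eq[THEN iffD1]) auto
  then have \<eta>: "2 * \<eta> * length l + 2 * \<eta> = d" "\<eta> > 0"
    by (simp add: algebra_simps) (simp add: \<eta>_def assms(3))
  have l: "fst ` set l \<subseteq> C" "snd ` set l \<subseteq> Y" using assms(2) by (auto simp: track_def)
  have E: "finite E" "E \<subseteq> C" using assms(1) l by (auto simp: E_def grid_def)
  have main: "\<exists>b\<in>E. z \<sqsubseteq> b \<and> (\<forall>y\<in>Y. \<bar>F z y - F b y\<bar> \<le> d) \<and>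
       (\<forall>G. (\<forall>(x, y)\<in>E \<times> snd ` set l. \<bar>G x y - F x y\<bar> < \<eta>) \<longrightarrow> (\<forall>l. track l \<longrightarrow> variation d G l \<le> k * d) \<longrightarrow>
            (\<forall>y\<in>Y. \<bar>G z y - G b y\<bar> \<le> 6 * d))" if z: "z \<in> C" for z
  proof -
    have "d \<ge> 0" using assms(3) by simp
    from track_insert[OF assms(2,1) z this] obtain a b where
      ab: "a \<in> E" "b \<in> E" "a \<sqsubseteq> z" "z \<sqsubseteq> b"
      and osc: "\<And>y. y \<in> Y \<Longrightarrow> \<bar>F a y - F b y\<bar> \<le> d" "\<And>y. y \<in> Y \<Longrightarrow> \<bar>F z y - F b y\<bar> \<le> d"
      and ins: "\<And>G y s. y \<in> Y \<Longrightarrow> s \<ge> 0 \<Longrightarrow> (\<And>w. w \<in> snd ` set l \<Longrightarrow> \<bar>G a w - G b w\<bar> \<le> s) \<Longrightarrow>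
       \<exists>l'. track l' \<and> variation d G l' \<ge> variation d G l - 3 * d + \<bar>G z y - G b y\<bar> - s"
      unfolding E_def by metis
    have "\<bar>G z y - G b y\<bar> \<le> 6 * d"
      if G: "\<forall>(x, y)\<in>E \<times> snd ` set l. \<bar>G x y - F x y\<bar> < \<eta>"
        and max: "\<forall>l. track l \<longrightarrow> variation d G l \<le> k * d" and y: "y \<in> Y" for G y
    proof -
      have "\<bar>G a w - G b w\<bar> \<le> d + 2 * \<eta>" if "w \<in> snd ` set l" for w
      proof -
        have "\<bar>G a w - F a w\<bar> < \<eta>" "\<bar>G b w - F b w\<bar> < \<eta>" using G ab that by auto
        then show ?thesis using osc(1)[of w] that l by force
      qed
      moreover have "d + 2 * \<eta> \<ge> 0" using \<eta> assms(3) by simp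
      ultimately obtain l' where l': "track l'"
        "variation d G l' \<ge> variation d G l - 3 * d + \<bar>G z y - G b y\<bar> - (d + 2 * \<eta>)"
        using ins[OF y] by blast
      moreover have "variation d G l \<ge> variation d F l - 2 * \<eta> * length l"
      proof (rule variation_perturb)
        show "\<bar>G x y - F x y\<bar> \<le> \<eta>" if "x \<in> E" "y \<in> snd ` set l" for x y
          using G that by fastforce
      qed (use \<eta> in \<open>auto simp: E_def\<close>)
      moreover have "variation d G l' \<le> k * d" using max l' by blast
      ultimately show ?thesis using \<eta>(1) k by (simp add: algebra_simps)
    qed
    then show ?thesis using ab osc by blast
  qed
  show ?thesis
  proof (rule that)
    show "finite (E \<times> snd ` set l)" "E \<times> snd ` set l \<subseteq> C \<times> Y" using E l by auto
  qed (fact \<eta>(2) E | blast intro: main)+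
qed

end

section \<open>Compact semilattices and their closed chains\<close>

text \<open>Used both for the extreme points of compact chains and for least elements of closed sublattices.\<close>

lemma compact_directed_has_least:
  assumes "compactin X T" "T \<noteq> {}"
    and closed: "\<And>q. q \<in> T \<Longrightarrow> closedin X {p \<in> topspace X. R p q}"
    and trans: "\<And>x y z. x \<in> T \<Longrightarrow> y \<in> T \<Longrightarrow> z \<in> T \<Longrightarrow> R x y \<Longrightarrow> R y z \<Longrightarrow> R x z"
    and directed: "\<And>x y. x \<in> T \<Longrightarrow> y \<in> T \<Longrightarrow> \<exists>m\<in>T. R m x \<and> R m y"
  shows "\<exists>m\<in>T. \<forall>q\<in>T. R m q"
proof -
  define D where "D q = {p \<in> topspace X. R p q}" for q
  have TX: "T \<subseteq> topspace X" using assms(1) compactin_subset_topspace by blast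
  have fin: "\<exists>m\<in>T. \<forall>q\<in>F. R m q" if "finite F" "F \<subseteq> T" for F
    using that
  proof (induction F)
    case empty
    then show ?case using assms(2) by blast
  next
    case (insert q F)
    then obtain m where m: "m \<in> T" "\<forall>q\<in>F. R m q" by auto
    obtain m' where "m' \<in> T" "R m' m" "R m' q" using directed[of m q] m insert.prems by auto
    then show ?case using m insert.prems trans[of m' m] by blast
  qed
  have "T \<inter> \<Inter>(D ` T) \<noteq> {}"
  proof (rule compactin_fip[THEN iffD1, OF assms(1), THEN conjunct2, rule_format], intro conjI ballI allI impI)
    show "closedin X U" if "U \<in> D ` T" for U using that closed by (auto simp: D_def)
    show "T \<inter> \<Inter>\<F> \<noteq> {}" if F: "finite \<F> \<and> \<F> \<subseteq> D ` T" for \<F>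
    proof -
      obtain F where F: "finite F" "F \<subseteq> T" "\<F> = D ` F" using F finite_subset_image by metis
      obtain m where "m \<in> T" "\<forall>q\<in>F. R m q" using fin F by blast
      then have "m \<in> T \<inter> \<Inter>\<F>" using TX F by (auto simp: D_def)
      then show ?thesis by blast
    qed
  qed
  then show ?thesis by (auto simp: D_def)
qed

text \<open>In a compact chain with closed rays, a neighbourhood \<open>W\<close> of \<open>s\<close> contains an interval \<open>[a, s]\<close>, which may
  be trivial if \<open>s\<close> has an immediate predecessor: the points below \<open>s\<close> outside \<open>W\<close> form a compact set,
  and \<open>a\<close> is taken above its maximum \<open>t\<close>, strictly between \<open>t\<close> and \<open>s\<close> if possible. The relation \<open>R\<close> is arbitrary so that the lemma can be used for
  both directions of the order.\<close>

lemma compact_chain_one_sided_neighbourhood: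
  assumes C: "compactin X C"
    and below: "\<And>q. q \<in> C \<Longrightarrow> closedin X {p \<in> topspace X. R p q}"
    and above: "\<And>q. q \<in> C \<Longrightarrow> closedin X {p \<in> topspace X. R q p}"
    and trans: "\<And>x y z. x \<in> C \<Longrightarrow> y \<in> C \<Longrightarrow> z \<in> C \<Longrightarrow> R x y \<Longrightarrow> R y z \<Longrightarrow> R x z"
    and antisym: "\<And>x y. x \<in> C \<Longrightarrow> y \<in> C \<Longrightarrow> R x y \<Longrightarrow> R y x \<Longrightarrow> x = y"
    and total: "\<And>x y. x \<in> C \<Longrightarrow> y \<in> C \<Longrightarrow> R x y \<or> R y x"
    and W: "openin X W" and s: "s \<in> C" "s \<in> W"
  shows "\<exists>a\<in>C. \<exists>N. R a s \<and> openin X N \<and> s \<in> N \<and>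
    (\<forall>z\<in>N \<inter> C. R z s \<longrightarrow> z = s \<or> R a z \<and> (\<forall>x\<in>C. R a x \<longrightarrow> R x s \<longrightarrow> x \<in> W))"
proof -
  have witness: ?thesis
    if "a \<in> C" "R a s" "openin X N" "s \<in> N"
      "\<And>z. z \<in> N \<Longrightarrow> z \<in> C \<Longrightarrow> R z s \<Longrightarrow> z = s \<or> R a z \<and> (\<forall>x\<in>C. R a x \<longrightarrow> R x s \<longrightarrow> x \<in> W)" for a N
    using that by blast
  define T where "T = {x \<in> C. R x s} - W"
  have CX: "C \<subseteq> topspace X" using C compactin_subset_topspace by blast
  have refl: "R x x" if "x \<in> C" for x using total[OF that that] by blast
  have T_eq: "T = C \<inter> ({p \<in> topspace X. R p s} - W)" using CX by (auto simp: T_def)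
  have T: "compactin X T"
    unfolding T_eq using C below[OF s(1)] W by (intro compact_Int_closedin closedin_diff)
  show ?thesis
  proof (cases "T = {}")
    case True
    have "\<exists>m\<in>C. \<forall>q\<in>C. R m q"
    proof (rule compact_directed_has_least[OF C])
      show "\<exists>m\<in>C. R m x \<and> R m y" if "x \<in> C" "y \<in> C" for x y
        using total[OF that] refl that by blast
      show "C \<noteq> {}" using s by blast
    qed (fact below trans)+
    then obtain m where m: "m \<in> C" "\<forall>q\<in>C. R m q" by blast
    show ?thesis
    proof (rule witness[of m "topspace X"])
      show "z = s \<or> R m z \<and> (\<forall>x\<in>C. R m x \<longrightarrow> R x s \<longrightarrow> x \<in> W)" if "z \<in> C" for z
        using True m that by (auto simp: T_def)
    qed (use m s CX in auto)
  next
    case False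
    have "\<exists>m\<in>T. \<forall>q\<in>T. R q m"
    proof (rule compact_directed_has_least[OF T False])
      show "\<exists>m\<in>T. R x m \<and> R y m" if "x \<in> T" "y \<in> T" for x y
        using total[of x y] refl that by (auto simp: T_def)
      show "closedin X {p \<in> topspace X. R q p}" if "q \<in> T" for q
        using that above by (auto simp: T_def)
      show "R z x" if "x \<in> T" "y \<in> T" "z \<in> T" "R y x" "R z y" for x y z
        using that trans[of z y x] by (auto simp: T_def)
    qed
    then obtain t where t: "t \<in> C" "R t s" "t \<notin> W" "\<And>q. q \<in> T \<Longrightarrow> R q t" by (auto simp: T_def)
    show ?thesis
    proof (cases "\<exists>a\<in>C. R t a \<and> R a s \<and> a \<noteq> t \<and> a \<noteq> s")
      case True
      then obtain a where a: "a \<in> C" "R t a" "R a s" "a \<noteq> t" "a \<noteq> s" by blast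
      show ?thesis
      proof (rule witness[of a "topspace X - {p \<in> topspace X. R p a}"])
        show "openin X (topspace X - {p \<in> topspace X. R p a})" using below a by blast
        show "s \<in> topspace X - {p \<in> topspace X. R p a}" using s CX a antisym by blast
        have "x \<in> W" if "x \<in> C" "R a x" "R x s" for x
        proof (rule ccontr)
          assume "x \<notin> W"
          then have "R x t" using t(4) that by (auto simp: T_def)
          then have "R a t" using trans[of a x t] that a t by blast
          then show False using a t antisym by blast
        qed
        then show "z = s \<or> R a z \<and> (\<forall>x\<in>C. R a x \<longrightarrow> R x s \<longrightarrow> x \<in> W)"
          if "z \<in> topspace X - {p \<in> topspace X. R p a}" "z \<in> C" for z
          using that a total by blast
      qed (use a in auto)
    next
      case no: False
      show ?thesis
      proof (rule witness[of s "topspace X - {p \<in> topspace X. R p t}"])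
        show "openin X (topspace X - {p \<in> topspace X. R p t})" using below t by blast
        show "s \<in> topspace X - {p \<in> topspace X. R p t}" using s CX t antisym by blast
        show "z = s \<or> R s z \<and> (\<forall>x\<in>C. R s x \<longrightarrow> R x s \<longrightarrow> x \<in> W)"
          if "z \<in> topspace X - {p \<in> topspace X. R p t}" "z \<in> C" "R z s" for z
          using that no t total[of z t] refl[of t] by blast
      qed (use s refl in auto)
    qed
  qed
qed

locale compact_semilattice =
  fixes X :: "'a topology" and join :: "'a \<Rightarrow> 'a \<Rightarrow> 'a" (infixl "\<squnion>" 65)
  assumes compact: "compact_space X" and hausdorff: "Hausdorff_space X"
    and join_continuous: "continuous_map (prod_topology X X) X (\<lambda>(x, y). x \<squnion> y)"
    and join_assoc: "x \<in> topspace X \<Longrightarrow> y \<in> topspace X \<Longrightarrow> z \<in> topspace X \<Longrightarrow> x \<squnion> y \<squnion> z = x \<squnion> (y \<squnion> z)"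
    and join_commute: "x \<in> topspace X \<Longrightarrow> y \<in> topspace X \<Longrightarrow> x \<squnion> y = y \<squnion> x"
    and join_idem: "x \<in> topspace X \<Longrightarrow> x \<squnion> x = x"
begin

definition le :: "'a \<Rightarrow> 'a \<Rightarrow> bool" (infix "\<sqsubseteq>" 50) where
  "x \<sqsubseteq> y \<longleftrightarrow> x \<squnion> y = y"

lemma join_in [simp]: "x \<in> topspace X \<Longrightarrow> y \<in> topspace X \<Longrightarrow> x \<squnion> y \<in> topspace X"
  using continuous_map_image_subset_topspace[OF join_continuous] by fastforce

lemma le_refl: "x \<in> topspace X \<Longrightarrow> x \<sqsubseteq> x"
  by (simp add: le_def join_idem)

lemma le_trans: "x \<in> topspace X \<Longrightarrow> y \<in> topspace X \<Longrightarrow> z \<in> topspace X \<Longrightarrow> x \<sqsubseteq> y \<Longrightarrow> y \<sqsubseteq> z \<Longrightarrow> x \<sqsubseteq> z"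
  unfolding le_def by (metis join_assoc)

lemma le_antisym: "x \<in> topspace X \<Longrightarrow> y \<in> topspace X \<Longrightarrow> x \<sqsubseteq> y \<Longrightarrow> y \<sqsubseteq> x \<Longrightarrow> x = y"
  unfolding le_def by (metis join_commute)

lemma join_upper:
  assumes "x \<in> topspace X" "y \<in> topspace X"
  shows "x \<sqsubseteq> x \<squnion> y" "y \<sqsubseteq> x \<squnion> y"
  using assms unfolding le_def by (metis join_assoc join_commute join_idem)+

lemma join_least:
  "x \<in> topspace X \<Longrightarrow> y \<in> topspace X \<Longrightarrow> z \<in> topspace X \<Longrightarrow> x \<sqsubseteq> z \<Longrightarrow> y \<sqsubseteq> z \<Longrightarrow> x \<squnion> y \<sqsubseteq> z"
  unfolding le_def by (metis join_assoc)

lemma continuous_map_join_left: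
  assumes "q \<in> topspace X"
  shows "continuous_map X X (\<lambda>p. q \<squnion> p)" "continuous_map X X (\<lambda>p. p \<squnion> q)"
proof -
  have "continuous_map X X ((\<lambda>(x, y). x \<squnion> y) \<circ> (\<lambda>p. (q, p)))"
       "continuous_map X X ((\<lambda>(x, y). x \<squnion> y) \<circ> (\<lambda>p. (p, q)))"
    using assms by (auto intro!: continuous_map_compose[OF _ join_continuous] continuous_map_pairedI)
  then show "continuous_map X X (\<lambda>p. q \<squnion> p)" "continuous_map X X (\<lambda>p. p \<squnion> q)"
    by (simp_all add: o_def)
qed

lemma closedin_below: "q \<in> topspace X \<Longrightarrow> closedin X {p \<in> topspace X. p \<sqsubseteq> q}"
  unfolding le_def
  by (intro closedin_continuous_maps_eq[OF hausdorff] continuous_map_join_left) auto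

lemma closedin_above: "q \<in> topspace X \<Longrightarrow> closedin X {p \<in> topspace X. q \<sqsubseteq> p}"
  unfolding le_def
  by (intro closedin_continuous_maps_eq[OF hausdorff] continuous_map_join_left) (auto simp: id_def[symmetric])

definition chain_in :: "'a set \<Rightarrow> bool" where
  "chain_in C \<longleftrightarrow> C \<subseteq> topspace X \<and> (\<forall>x\<in>C. \<forall>y\<in>C. x \<sqsubseteq> y \<or> y \<sqsubseteq> x)"

text \<open>The points comparable to a given point form a closed set; this passes comparability first from
  \<open>C\<close> to its closure in one argument, then in the other.\<close>

lemma closure_of_chain:
  assumes "chain_in C"
  shows "chain_in (X closure_of C)"
proof -
  define K where "K q = {p \<in> topspace X. p \<sqsubseteq> q \<or> q \<sqsubseteq> p}" for q
  have K: "closedin X (K q)" if "q \<in> topspace X" for q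
  proof -
    have "K q = {p \<in> topspace X. p \<sqsubseteq> q} \<union> {p \<in> topspace X. q \<sqsubseteq> p}" by (auto simp: K_def)
    then show ?thesis using that closedin_below closedin_above by (simp add: closedin_Un)
  qed
  have C: "C \<subseteq> topspace X" "\<And>x y. x \<in> C \<Longrightarrow> y \<in> C \<Longrightarrow> x \<sqsubseteq> y \<or> y \<sqsubseteq> x"
    using assms by (auto simp: chain_in_def)
  have 1: "X closure_of C \<subseteq> K q" if "q \<in> C" for q
    using that C by (intro closure_of_minimal K) (auto simp: K_def)
  have 2: "X closure_of C \<subseteq> K p" if "p \<in> X closure_of C" for p
    using 1 that C closure_of_subset_topspace[of X C]
    by (intro closure_of_minimal K) (auto simp: K_def)
  show ?thesis
    using 2 closure_of_subset_topspace[of X C] unfolding chain_in_def K_def by blast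
qed

lemma chain_carrier_of_chain: "chain_in C \<Longrightarrow> chain_carrier C (\<sqsubseteq>)"
  by unfold_locales (use le_trans in \<open>auto simp: chain_in_def intro: le_refl\<close>)

text \<open>By compactness in \<open>y\<close>, the projection of the closed set of bad pairs \<open>(x, y)\<close> is closed.\<close>

lemma openin_join_uniformly_close:
  assumes f: "continuous_map X euclideanreal f" and s: "s \<in> topspace X"
  shows "openin X {x \<in> topspace X. \<forall>y\<in>topspace X. \<bar>f (x \<squnion> y) - f (s \<squnion> y)\<bar> < e}"
proof -
  define g where "g = (\<lambda>p. \<bar>(f \<circ> (\<lambda>(x, y). x \<squnion> y)) p - (f \<circ> (\<lambda>p. s \<squnion> p) \<circ> snd) p\<bar>)"
  have "continuous_map (prod_topology X X) euclideanreal g"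
    unfolding g_def using f s
    by (intro continuous_map_real_abs continuous_map_diff continuous_map_compose[OF join_continuous]
        continuous_map_compose[OF continuous_map_snd] continuous_map_compose[OF continuous_map_join_left(1)]) auto
  then have "closedin (prod_topology X X) {p \<in> topspace (prod_topology X X). g p \<in> {e..}}"
    by (rule closedin_continuous_map_preimage) simp
  then have "closedin X (fst ` {p \<in> topspace (prod_topology X X). g p \<in> {e..}})"
    using closed_map_fst[OF compact] unfolding closed_map_def by blast
  moreover have "{x \<in> topspace X. \<forall>y\<in>topspace X. \<bar>f (x \<squnion> y) - f (s \<squnion> y)\<bar> < e} =
      topspace X - fst ` {p \<in> topspace (prod_topology X X). g p \<in> {e..}}"
    by (force simp: g_def not_le[symmetric] image_iff)
  ultimately show ?thesis by (simp add: openin_diff)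
qed

text \<open>Each point \<open>s\<close> of the chain has a neighbourhood whose points are served by at most two pieces \<open>[a, s]\<close>
  and \<open>[s, b]\<close>; finitely many such neighbourhoods cover the chain.\<close>

lemma grid_exists:
  assumes C: "chain_in C" "closedin X C" and f: "continuous_map X euclideanreal f" and d: "d > 0"
  shows "\<exists>A. chain_carrier.grid C (\<sqsubseteq>) (topspace X) (\<lambda>x y. f (x \<squnion> y)) d A"
proof -
  interpret chain_carrier C "(\<sqsubseteq>)" "topspace X" by (rule chain_carrier_of_chain[OF C(1)])
  have CX: "C \<subseteq> topspace X" using C(1) by (auto simp: chain_in_def)
  have comp: "compactin X C" using closedin_compact_space[OF compact C(2)] .
  define good where "good A z \<longleftrightarrow> (\<exists>a\<in>A. \<exists>b\<in>A. a \<sqsubseteq> z \<and> z \<sqsubseteq> b \<and>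
        (\<forall>x\<in>C. \<forall>x'\<in>C. \<forall>y\<in>topspace X. a \<sqsubseteq> x \<longrightarrow> x \<sqsubseteq> b \<longrightarrow> a \<sqsubseteq> x' \<longrightarrow> x' \<sqsubseteq> b \<longrightarrow>
            \<bar>f (x \<squnion> y) - f (x' \<squnion> y)\<bar> \<le> d))" for A z
  have "\<exists>N A. openin X N \<and> s \<in> N \<and> finite A \<and> A \<subseteq> C \<and> (\<forall>z\<in>N \<inter> C. good A z)" if s: "s \<in> C" for s
  proof -
    define W where "W = {x \<in> topspace X. \<forall>y\<in>topspace X. \<bar>f (x \<squnion> y) - f (s \<squnion> y)\<bar> < d / 2}"
    have W: "openin X W" "s \<in> W"
      using openin_join_uniformly_close[OF f, of s "d / 2"] s CX d unfolding W_def by auto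
    have osc: "\<bar>f (x \<squnion> y) - f (x' \<squnion> y)\<bar> \<le> d" if "x \<in> W" "x' \<in> W" "y \<in> topspace X" for x x' y
    proof -
      have "\<bar>f (x \<squnion> y) - f (s \<squnion> y)\<bar> < d / 2" "\<bar>f (x' \<squnion> y) - f (s \<squnion> y)\<bar> < d / 2"
        using that by (auto simp: W_def)
      then show ?thesis by linarith
    qed
    have cl: "closedin X {p \<in> topspace X. p \<sqsubseteq> q}" "closedin X {p \<in> topspace X. q \<sqsubseteq> p}" if "q \<in> C" for q
      using that CX closedin_below closedin_above by auto
    have anti: "x = y" if "x \<in> C" "y \<in> C" "x \<sqsubseteq> y" "y \<sqsubseteq> x" for x y
      using that CX le_antisym by blast
    have rev: "x \<in> C \<Longrightarrow> y \<in> C \<Longrightarrow> z \<in> C \<Longrightarrow> y \<sqsubseteq> x \<Longrightarrow> z \<sqsubseteq> y \<Longrightarrow> z \<sqsubseteq> x"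
      "x \<in> C \<Longrightarrow> y \<in> C \<Longrightarrow> y \<sqsubseteq> x \<or> x \<sqsubseteq> y"
      "x \<in> C \<Longrightarrow> y \<in> C \<Longrightarrow> y \<sqsubseteq> x \<Longrightarrow> x \<sqsubseteq> y \<Longrightarrow> x = y" for x y z
      using chain_trans chain_total anti by blast+
    have "\<exists>a\<in>C. \<exists>N. a \<sqsubseteq> s \<and> openin X N \<and> s \<in> N \<and>
        (\<forall>z\<in>N \<inter> C. z \<sqsubseteq> s \<longrightarrow> z = s \<or> a \<sqsubseteq> z \<and> (\<forall>x\<in>C. a \<sqsubseteq> x \<longrightarrow> x \<sqsubseteq> s \<longrightarrow> x \<in> W))"
      by (rule compact_chain_one_sided_neighbourhood[where R = "(\<sqsubseteq>)", OF comp])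
        (fact cl chain_trans anti chain_total W s)+
    then obtain a M where a: "a \<in> C" "a \<sqsubseteq> s" "openin X M" "s \<in> M"
      and aM: "\<forall>z\<in>M \<inter> C. z \<sqsubseteq> s \<longrightarrow> z = s \<or> a \<sqsubseteq> z \<and> (\<forall>x\<in>C. a \<sqsubseteq> x \<longrightarrow> x \<sqsubseteq> s \<longrightarrow> x \<in> W)"
      by blast
    have "\<exists>b\<in>C. \<exists>N. s \<sqsubseteq> b \<and> openin X N \<and> s \<in> N \<and>
        (\<forall>z\<in>N \<inter> C. s \<sqsubseteq> z \<longrightarrow> z = s \<or> z \<sqsubseteq> b \<and> (\<forall>x\<in>C. x \<sqsubseteq> b \<longrightarrow> s \<sqsubseteq> x \<longrightarrow> x \<in> W))"
      by (rule compact_chain_one_sided_neighbourhood[where R = "\<lambda>x y. y \<sqsubseteq> x", OF comp])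
        (fact cl rev W s)+
    then obtain b M' where b: "b \<in> C" "s \<sqsubseteq> b" "openin X M'" "s \<in> M'"
      and bM: "\<forall>z\<in>M' \<inter> C. s \<sqsubseteq> z \<longrightarrow> z = s \<or> z \<sqsubseteq> b \<and> (\<forall>x\<in>C. x \<sqsubseteq> b \<longrightarrow> s \<sqsubseteq> x \<longrightarrow> x \<in> W)"
      by blast
    have "good {a, s, b} z" if z: "z \<in> M \<inter> M'" "z \<in> C" for z
    proof -
      have "z = s \<or> a \<sqsubseteq> z \<and> z \<sqsubseteq> s \<and> (\<forall>x\<in>C. a \<sqsubseteq> x \<longrightarrow> x \<sqsubseteq> s \<longrightarrow> x \<in> W)
          \<or> s \<sqsubseteq> z \<and> z \<sqsubseteq> b \<and> (\<forall>x\<in>C. x \<sqsubseteq> b \<longrightarrow> s \<sqsubseteq> x \<longrightarrow> x \<in> W)"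
        using aM bM z chain_total[OF s z(2)] by blast
      then show ?thesis
      proof (elim disjE conjE)
        assume "z = s"
        then have "x \<in> W" if "x \<in> C" "s \<sqsubseteq> x" "x \<sqsubseteq> s" for x
          using that s CX W le_antisym[of x s] by auto
        then show ?thesis
          unfolding good_def using osc \<open>z = s\<close> chain_refl[OF s]
          by (intro bexI[of _ s] conjI ballI impI) auto
      next
        assume "a \<sqsubseteq> z" "z \<sqsubseteq> s" "\<forall>x\<in>C. a \<sqsubseteq> x \<longrightarrow> x \<sqsubseteq> s \<longrightarrow> x \<in> W"
        then show ?thesis
          unfolding good_def using osc by (intro bexI[of _ a] bexI[of _ s] conjI ballI impI) auto
      next
        assume "s \<sqsubseteq> z" "z \<sqsubseteq> b" "\<forall>x\<in>C. x \<sqsubseteq> b \<longrightarrow> s \<sqsubseteq> x \<longrightarrow> x \<in> W"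
        then show ?thesis
          unfolding good_def using osc by (intro bexI[of _ s] bexI[of _ b] conjI ballI impI) auto
      qed
    qed
    then show ?thesis
      using a b s by (intro exI[of _ "M \<inter> M'"] exI[of _ "{a, s, b}"]) auto
  qed
  then obtain N A where NA: "\<And>s. s \<in> C \<Longrightarrow> openin X (N s) \<and> s \<in> N s \<and> finite (A s) \<and> A s \<subseteq> C \<and> (\<forall>z\<in>N s \<inter> C. good (A s) z)"
    by metis
  have "\<exists>\<F>. finite \<F> \<and> \<F> \<subseteq> N ` C \<and> C \<subseteq> \<Union>\<F>"
    using NA by (intro compactinD[OF comp]) auto
  then obtain J where J: "finite J" "J \<subseteq> C" "C \<subseteq> \<Union>(N ` J)" by (metis finite_subset_image)
  have "grid (\<lambda>x y. f (x \<squnion> y)) d (\<Union>(A ` J))"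
    unfolding grid_def good_def[symmetric]
  proof (intro conjI ballI)
    show "finite (\<Union>(A ` J))" "\<Union>(A ` J) \<subseteq> C" using NA J by auto
    show "good (\<Union>(A ` J)) z" if z: "z \<in> C" for z
    proof -
      obtain s where s: "s \<in> J" "z \<in> N s" using J z by blast
      then have "good (A s) z" using NA J z by blast
      then show ?thesis using s(1) unfolding good_def by (meson UN_I)
    qed
  qed
  then show ?thesis by blast
qed

end

section \<open>Semilattices generated by finitely many chains\<close>

lemma openin_pointwise_neighbourhood:
  assumes "finite P" "P \<subseteq> topspace T"
  shows "openin (pointwise_topology T) {g \<in> C_space T. \<forall>p\<in>P. \<bar>g p - f p\<bar> < (e::real)}"
proof -
  let ?\<Pi> = "product_topology (\<lambda>_. euclideanreal) (topspace T)"
  have "openin ?\<Pi> {g \<in> topspace ?\<Pi>. g p \<in> ball (f p) e}" if "p \<in> P" for p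
    using that assms(2)
    by (intro openin_continuous_map_preimage[OF continuous_map_product_projection]) auto
  then have "openin (pointwise_topology T) (C_space T \<inter> {g \<in> topspace ?\<Pi>. g p \<in> ball (f p) e})" if "p \<in> P" for p
    using that unfolding pointwise_topology_def openin_subtopology_alt by blast
  then have "openin (pointwise_topology T)
      ((\<Inter>p\<in>P. C_space T \<inter> {g \<in> topspace ?\<Pi>. g p \<in> ball (f p) e}) \<inter> topspace (pointwise_topology T))"
    using assms(1) openin_topspace by (intro openin_INT) auto
  moreover have "{g \<in> C_space T. \<forall>p\<in>P. \<bar>g p - f p\<bar> < e} =
      (\<Inter>p\<in>P. C_space T \<inter> {g \<in> topspace ?\<Pi>. g p \<in> ball (f p) e}) \<inter> topspace (pointwise_topology T)"
    by (auto simp: dist_real_def abs_minus_commute C_space_def PiE_UNIV_domain PiE_def)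
  ultimately show ?thesis by simp
qed

lemma mdiam_C_metric_le:
  assumes T: "compact_space T" "topspace T \<noteq> {}" and S: "S \<subseteq> C_space T"
    and close: "\<And>g x. g \<in> S \<Longrightarrow> x \<in> topspace T \<Longrightarrow> \<bar>g x - f x\<bar> \<le> (\<kappa>::real)"
  shows "mdiam (C_metric T) S \<le> ennreal (2 * \<kappa>)"
  unfolding mdiam_def
proof (intro SUP_least ennreal_leI)
  fix g h assume gh: "g \<in> S" "h \<in> S"
  have "mdist (C_metric T) g h = (SUP x\<in>topspace T. \<bar>g x - h x\<bar>)"
    using gh S T by (intro mdist_C_metric) auto
  also have "\<dots> \<le> 2 * \<kappa>"
  proof (rule cSUP_least[OF T(2)])
    fix x assume "x \<in> topspace T"
    then show "\<bar>g x - h x\<bar> \<le> 2 * \<kappa>" using close[of g x] close[of h x] gh by linarith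
  qed
  finally show "mdist (C_metric T) g h \<le> 2 * \<kappa>" .
qed

context compact_semilattice
begin

text \<open>Instead of the supremum of the variation over all tracks, the least integer multiple of \<open>d\<close> that
  bounds it is used: it is the bin into which the supremum falls.\<close>

definition variation_bound :: "'a set \<Rightarrow> real \<Rightarrow> ('a \<Rightarrow> real) \<Rightarrow> nat \<Rightarrow> bool" where
  "variation_bound C d f k \<longleftrightarrow> (\<forall>l. chain_carrier.track C (\<sqsubseteq>) (topspace X) l \<longrightarrow>
     variation d (\<lambda>x y. f (x \<squnion> y)) l \<le> real k * d)"

lemma variation_bound_exists:
  assumes C: "chain_in C" "closedin X C" and f: "continuous_map X euclideanreal f" and d: "d > 0"
  shows "\<exists>k. variation_bound C d f k"
proof -
  interpret chain_carrier C "(\<sqsubseteq>)" "topspace X" by (rule chain_carrier_of_chain[OF C(1)])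
  obtain A where A: "grid (\<lambda>x y. f (x \<squnion> y)) d A" using grid_exists[OF C f d] by blast
  have "compactin euclideanreal (f ` topspace X)"
    using image_compactin[OF _ f] compact by (simp add: compact_space_def)
  then have "bounded (f ` topspace X)" by (simp add: compact_imp_bounded)
  then obtain B where B: "B > 0" "\<And>p. p \<in> topspace X \<Longrightarrow> \<bar>f p\<bar> \<le> B"
    unfolding bounded_pos by auto
  have CX: "C \<subseteq> topspace X" using C(1) by (auto simp: chain_in_def)
  have "variation d (\<lambda>x y. f (x \<squnion> y)) l \<le> (2 * B) * card A" if "track l" for l
  proof (rule grid_bounds_variation[OF A d _ _ that])
    show "\<bar>f (x \<squnion> y) - f (x' \<squnion> y)\<bar> \<le> 2 * B" if "x \<in> C" "x' \<in> C" "y \<in> topspace X" for x x' y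
    proof -
      have "\<bar>f (x \<squnion> y)\<bar> \<le> B" "\<bar>f (x' \<squnion> y)\<bar> \<le> B" using that CX B(2) by auto
      then show ?thesis by linarith
    qed
  qed (use B in simp)
  moreover obtain k :: nat where "(2 * B) * card A < real k * d"
    using reals_Archimedean3[OF d] by blast
  ultimately show ?thesis unfolding variation_bound_def by (meson less_imp_le order_trans)
qed

text \<open>The set \<open>P\<close> consists of the finitely many points at which \<open>g\<close> must be close to \<open>f\<close>. If \<open>k\<close> is positive,
  then its minimality provides a track of variation above \<open>(k - 1) * d\<close>; if it is zero, then the empty
  track is good enough.\<close>

lemma least_variation_bound_rigid:
  assumes C: "chain_in C" "closedin X C" and f: "continuous_map X euclideanreal f" and d: "d > 0"
    and k: "k = (LEAST k. variation_bound C d f k)"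
  shows "\<exists>P \<eta> E. finite P \<and> P \<subseteq> topspace X \<and> \<eta> > 0 \<and> finite E \<and> E \<subseteq> C \<and>
    (\<forall>z\<in>C. \<exists>b\<in>E. z \<sqsubseteq> b \<and> (\<forall>y\<in>topspace X. \<bar>f (z \<squnion> y) - f (b \<squnion> y)\<bar> \<le> d) \<and>
       (\<forall>g. (\<forall>p\<in>P. \<bar>g p - f p\<bar> < \<eta>) \<longrightarrow> variation_bound C d g k \<longrightarrow>
            (\<forall>y\<in>topspace X. \<bar>g (z \<squnion> y) - g (b \<squnion> y)\<bar> \<le> 6 * d)))"
proof -
  interpret chain_carrier C "(\<sqsubseteq>)" "topspace X" by (rule chain_carrier_of_chain[OF C(1)])
  let ?F = "\<lambda>f x y. f (x \<squnion> y)"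
  obtain A where A: "grid (?F f) d A" using grid_exists[OF C f d] by blast
  have CX: "C \<subseteq> topspace X" using C(1) by (auto simp: chain_in_def)
  obtain l where l: "track l" "(real k - 1) * d < variation d (?F f) l"
  proof (cases k)
    case 0
    then show ?thesis using that[of "[]"] d by (simp add: track_def)
  next
    case (Suc j)
    then have "\<not> variation_bound C d f j" using k not_less_Least[of j "variation_bound C d f"] by auto
    then obtain l where "track l" "real j * d < variation d (?F f) l"
      by (auto simp: variation_bound_def not_le)
    then show ?thesis using that Suc by simp
  qed
  obtain Q \<eta> E where Q: "finite Q" "Q \<subseteq> C \<times> topspace X" "\<eta> > 0" "finite E" "E \<subseteq> C"
    and rigid: "\<forall>z\<in>C. \<exists>b\<in>E. z \<sqsubseteq> b \<and> (\<forall>y\<in>topspace X. \<bar>?F f z y - ?F f b y\<bar> \<le> d) \<and>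
       (\<forall>G. (\<forall>(x, y)\<in>Q. \<bar>G x y - ?F f x y\<bar> < \<eta>) \<longrightarrow> (\<forall>l. track l \<longrightarrow> variation d G l \<le> real k * d) \<longrightarrow>
            (\<forall>y\<in>topspace X. \<bar>G z y - G b y\<bar> \<le> 6 * d))"
    by (rule near_maximal_variation_rigid[OF A l(1) d l(2)])
  define P where "P = (\<lambda>(x, y). x \<squnion> y) ` Q"
  have "\<exists>b\<in>E. z \<sqsubseteq> b \<and> (\<forall>y\<in>topspace X. \<bar>f (z \<squnion> y) - f (b \<squnion> y)\<bar> \<le> d) \<and>
       (\<forall>g. (\<forall>p\<in>P. \<bar>g p - f p\<bar> < \<eta>) \<longrightarrow> variation_bound C d g k \<longrightarrow>
            (\<forall>y\<in>topspace X. \<bar>g (z \<squnion> y) - g (b \<squnion> y)\<bar> \<le> 6 * d))" if "z \<in> C" for z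
  proof -
    from bspec[OF rigid that] obtain b where
      b: "b \<in> E" "z \<sqsubseteq> b" "\<forall>y\<in>topspace X. \<bar>?F f z y - ?F f b y\<bar> \<le> d"
      and G: "\<forall>G. (\<forall>(x, y)\<in>Q. \<bar>G x y - ?F f x y\<bar> < \<eta>) \<longrightarrow> (\<forall>l. track l \<longrightarrow> variation d G l \<le> real k * d) \<longrightarrow>
            (\<forall>y\<in>topspace X. \<bar>G z y - G b y\<bar> \<le> 6 * d)"
      by (elim bexE conjE) (rule that)
    have "\<forall>y\<in>topspace X. \<bar>g (z \<squnion> y) - g (b \<squnion> y)\<bar> \<le> 6 * d"
      if "\<forall>p\<in>P. \<bar>g p - f p\<bar> < \<eta>" "variation_bound C d g k" for g
    proof -
      have "\<forall>(x, y)\<in>Q. \<bar>g (x \<squnion> y) - f (x \<squnion> y)\<bar> < \<eta>" using that(1) by (auto simp: P_def)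
      then show ?thesis
        using G[THEN spec, of "?F g"] that(2) unfolding variation_bound_def by blast
    qed
    then show ?thesis by (intro bexI[OF _ b(1)] conjI b allI impI)
  qed
  moreover have "finite P" "P \<subseteq> topspace X"
    using Q(1) subset_trans[OF Q(2) Sigma_mono[OF CX subset_refl]] by (auto simp: P_def)
  ultimately show ?thesis
    using Q(3-5) by (intro exI[of _ P] exI[of _ \<eta>] exI[of _ E] conjI ballI)
qed

text \<open>The elements \<open>c j\<close> below \<open>z\<close> are replaced by the elements \<open>b j\<close>, one after the other: if \<open>t\<close> has been
  reached, then \<open>c i \<squnion> t = t\<close>, so passing from \<open>t\<close> to \<open>b i \<squnion> t\<close> changes each \<open>h \<in> H\<close> by at most \<open>e\<close>. The
  final \<open>t\<close> is the least upper bound of \<open>z\<close> and all the \<open>b j\<close>.\<close>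

lemma replace_joinands:
  fixes H :: "('a \<Rightarrow> real) set" and e :: real
  assumes "finite J" "z \<in> topspace X" "\<And>j. j \<in> J \<Longrightarrow> c j \<in> topspace X" "\<And>j. j \<in> J \<Longrightarrow> b j \<in> topspace X"
    and "\<And>j. j \<in> J \<Longrightarrow> c j \<sqsubseteq> z"
    and "\<And>h j y. h \<in> H \<Longrightarrow> j \<in> J \<Longrightarrow> y \<in> topspace X \<Longrightarrow> \<bar>h (c j \<squnion> y) - h (b j \<squnion> y)\<bar> \<le> e"
  shows "\<exists>t\<in>topspace X. z \<sqsubseteq> t \<and> (\<forall>j\<in>J. b j \<sqsubseteq> t) \<and>
    (\<forall>p\<in>topspace X. z \<sqsubseteq> p \<longrightarrow> (\<forall>j\<in>J. b j \<sqsubseteq> p) \<longrightarrow> t \<sqsubseteq> p) \<and> (\<forall>h\<in>H. \<bar>h z - h t\<bar> \<le> card J * e)"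
  using assms
proof (induction J)
  case empty
  then show ?case using le_refl by (intro bexI[of _ z]) auto
next
  case (insert i J)
  have "\<exists>t\<in>topspace X. z \<sqsubseteq> t \<and> (\<forall>j\<in>J. b j \<sqsubseteq> t) \<and>
    (\<forall>p\<in>topspace X. z \<sqsubseteq> p \<longrightarrow> (\<forall>j\<in>J. b j \<sqsubseteq> p) \<longrightarrow> t \<sqsubseteq> p) \<and> (\<forall>h\<in>H. \<bar>h z - h t\<bar> \<le> card J * e)"
    using insert.prems by (intro insert.IH) auto
  then obtain t where t: "t \<in> topspace X" "z \<sqsubseteq> t" "\<forall>j\<in>J. b j \<sqsubseteq> t"
      "\<forall>p\<in>topspace X. z \<sqsubseteq> p \<longrightarrow> (\<forall>j\<in>J. b j \<sqsubseteq> p) \<longrightarrow> t \<sqsubseteq> p" "\<forall>h\<in>H. \<bar>h z - h t\<bar> \<le> card J * e"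
    by blast
  have in_X: "c i \<in> topspace X" "b i \<in> topspace X" "\<And>j. j \<in> J \<Longrightarrow> b j \<in> topspace X" using insert.prems by auto
  have "c i \<sqsubseteq> t" using le_trans[of "c i" z t] insert.prems t in_X by auto
  then have ct: "c i \<squnion> t = t" by (simp add: le_def)
  have up: "t \<sqsubseteq> b i \<squnion> t" "b i \<sqsubseteq> b i \<squnion> t" using join_upper in_X t by auto
  show ?case
  proof (intro bexI[of _ "b i \<squnion> t"] conjI ballI impI)
    show "b i \<squnion> t \<in> topspace X" using in_X t by simp
    show "z \<sqsubseteq> b i \<squnion> t" using le_trans[OF _ _ _ t(2) up(1)] insert.prems(1) t in_X by simp
    show "b j \<sqsubseteq> b i \<squnion> t" if "j \<in> insert i J" for j
      using that up le_trans[of "b j" t "b i \<squnion> t"] t in_X by auto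
    show "b i \<squnion> t \<sqsubseteq> p" if "p \<in> topspace X" "z \<sqsubseteq> p" "\<forall>j\<in>insert i J. b j \<sqsubseteq> p" for p
      using that t in_X by (intro join_least) auto
    show "\<bar>h z - h (b i \<squnion> t)\<bar> \<le> card (insert i J) * e" if h: "h \<in> H" for h
    proof -
      have "\<bar>h (c i \<squnion> t) - h (b i \<squnion> t)\<bar> \<le> e" using insert.prems(5) h t by auto
      moreover have "\<bar>h z - h t\<bar> \<le> card J * e" using t h by blast
      ultimately have "\<bar>h z - h (b i \<squnion> t)\<bar> \<le> card J * e + e" unfolding ct by linarith
      then show ?thesis using insert.hyps by (simp add: algebra_simps)
    qed
  qed
qed

definition is_lub :: "'i set \<Rightarrow> ('i \<Rightarrow> 'a) \<Rightarrow> 'a \<Rightarrow> bool" where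
  "is_lub I c z \<longleftrightarrow> z \<in> topspace X \<and> (\<forall>i\<in>I. c i \<sqsubseteq> z) \<and> (\<forall>p\<in>topspace X. (\<forall>i\<in>I. c i \<sqsubseteq> p) \<longrightarrow> z \<sqsubseteq> p)"

lemma is_lub_unique: "is_lub I c z \<Longrightarrow> is_lub I c z' \<Longrightarrow> z = z'"
  unfolding is_lub_def using le_antisym by blast

text \<open>The pieces \<open>S m\<close> collect the functions with prescribed bins of their variations along the closed
  chains \<open>D i\<close>. Let \<open>f\<close> and \<open>g\<close> be in the same piece, with \<open>g\<close> close to \<open>f\<close> at finitely many points. Write
  \<open>z\<close> as the least upper bound of elements \<open>c i\<close> of the chains, and move every \<open>c i\<close> upwards to an element
  \<open>b i\<close> of a finite set. Then \<open>f\<close> and \<open>g\<close> change little, and \<open>z\<close> becomes the least upper bound of the \<open>b i\<close>.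
  There are finitely many such least upper bounds, so \<open>f\<close> and \<open>g\<close> can be required to be close there.\<close>

theorem SLD_if_join_generated_by_chains:
  fixes I :: "'i set"
  assumes I: "finite I" and ne: "topspace X \<noteq> {}" and chains: "\<And>i. i \<in> I \<Longrightarrow> chain_in (C i)"
    and gen: "\<And>z. z \<in> topspace X \<Longrightarrow> \<exists>c. (\<forall>i\<in>I. c i \<in> C i) \<and> is_lub I c z"
  shows "SLD (pointwise_topology X) (C_metric X)"
  unfolding SLD_def
proof (intro allI impI)
  fix \<epsilon> :: real assume \<epsilon>: "\<epsilon> > 0"
  define D where "D i = X closure_of C i" for i
  have D: "chain_in (D i)" "closedin X (D i)" "C i \<subseteq> D i" "D i \<subseteq> topspace X" if "i \<in> I" for i
    using closure_of_chain[OF chains[OF that]] chains[OF that] closure_of_subset[of "C i" X]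
    by (auto simp: D_def chain_in_def)
  \<comment> \<open>Comparing \<open>g\<close> with \<open>f\<close> at a point costs \<open>6 * d\<close> per chain for each of them, and \<open>d\<close> at the end;
    the diameter is twice that.\<close>
  define d where "d = \<epsilon> / (24 * card I + 4)"
  have d: "d > 0" using \<epsilon> by (simp add: d_def add_pos_nonneg add_nonneg_pos)
  have "d * (24 * card I + 4) = \<epsilon>"
    unfolding d_def by (rule nonzero_eq_divide_eq[THEN iffD1]) (auto simp: add_nonneg_eq_0_iff)
  then have d_\<epsilon>: "2 * (12 * card I * d + d) < \<epsilon>" using d by (simp add: algebra_simps)
  define level where "level f i = (LEAST k. variation_bound (D i) d f k)" for f i
  have level: "variation_bound (D i) d f (level f i)" if "f \<in> C_space X" "i \<in> I" for f i
    unfolding level_def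
    by (rule LeastI_ex) (use that variation_bound_exists D d in \<open>auto simp: C_space_def\<close>)
  obtain idx where idx: "set idx = I" using finite_list[OF I] by blast
  define S where "S m = {f \<in> C_space X. map (level f) idx = from_nat m}" for m :: nat
  have cover: "C_space X = (\<Union>m. S m)"
  proof -
    have "f \<in> S (to_nat (map (level f) idx))" if "f \<in> C_space X" for f
      using that by (simp add: S_def)
    moreover have "S m \<subseteq> C_space X" for m by (auto simp: S_def)
    ultimately show ?thesis by blast
  qed
  moreover have "\<exists>U. openin (pointwise_topology X) U \<and> f \<in> U \<and> mdiam (C_metric X) (U \<inter> S m) < ennreal \<epsilon>"
    if f: "f \<in> S m" for m f
  proof -
    have fC: "f \<in> C_space X" "continuous_map X euclideanreal f" using f by (auto simp: S_def C_space_def)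
    have same: "level g i = level f i" if "g \<in> S m" "i \<in> I" for g i
    proof -
      have "map (level g) idx = map (level f) idx" using that(1) f by (simp add: S_def)
      then show ?thesis using that(2) idx by (simp add: map_eq_conv)
    qed
    define ctrl where "ctrl i P \<eta> E \<longleftrightarrow> finite P \<and> P \<subseteq> topspace X \<and> \<eta> > 0 \<and> finite E \<and> E \<subseteq> D i \<and>
      (\<forall>z\<in>D i. \<exists>b\<in>E. z \<sqsubseteq> b \<and> (\<forall>y\<in>topspace X. \<bar>f (z \<squnion> y) - f (b \<squnion> y)\<bar> \<le> d) \<and>
       (\<forall>g. (\<forall>p\<in>P. \<bar>g p - f p\<bar> < \<eta>) \<longrightarrow> variation_bound (D i) d g (level f i) \<longrightarrow>
            (\<forall>y\<in>topspace X. \<bar>g (z \<squnion> y) - g (b \<squnion> y)\<bar> \<le> 6 * d)))" for i P E and \<eta> :: real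
    have "\<exists>P \<eta> E. ctrl i P \<eta> E" if "i \<in> I" for i
      unfolding ctrl_def by (rule least_variation_bound_rigid[OF D(1,2)[OF that] fC(2) d]) (simp add: level_def)
    then obtain P \<eta> E where ctrl: "\<And>i. i \<in> I \<Longrightarrow> ctrl i (P i) (\<eta> i) (E i)" by metis
    have P: "finite (P i)" "P i \<subseteq> topspace X" "\<eta> i > 0" "finite (E i)" "E i \<subseteq> D i" if "i \<in> I" for i
      using ctrl[OF that] by (simp_all add: ctrl_def)
    have rigid: "\<forall>z\<in>D i. \<exists>b\<in>E i. z \<sqsubseteq> b \<and> (\<forall>y\<in>topspace X. \<bar>f (z \<squnion> y) - f (b \<squnion> y)\<bar> \<le> d) \<and>
       (\<forall>g. (\<forall>p\<in>P i. \<bar>g p - f p\<bar> < \<eta> i) \<longrightarrow> variation_bound (D i) d g (level f i) \<longrightarrow>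
            (\<forall>y\<in>topspace X. \<bar>g (z \<squnion> y) - g (b \<squnion> y)\<bar> \<le> 6 * d))" if "i \<in> I" for i
      using ctrl[OF that] unfolding ctrl_def by (elim conjE)
    \<comment> \<open>Families without a least upper bound contribute a meaningless value, which may lie outside of \<open>X\<close>.\<close>
    define B where "B = (\<lambda>b. THE t. is_lub I b t) ` (\<Pi>\<^sub>E i\<in>I. E i) \<inter> topspace X"
    have B: "finite B" using I P(4) by (auto simp: B_def intro!: finite_imageI finite_PiE)
    define \<eta>0 where "\<eta>0 = Min (insert d (\<eta> ` I))"
    have \<eta>0: "\<eta>0 > 0" "\<eta>0 \<le> d" "\<And>i. i \<in> I \<Longrightarrow> \<eta>0 \<le> \<eta> i"
      using I P(3) d by (auto simp: \<eta>0_def)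
    define Q where "Q = B \<union> (\<Union>i\<in>I. P i)"
    define U where "U = {g \<in> C_space X. \<forall>p\<in>Q. \<bar>g p - f p\<bar> < \<eta>0}"
    have U: "openin (pointwise_topology X) U"
      unfolding U_def using I B P(1,2)
      by (intro openin_pointwise_neighbourhood) (auto simp: Q_def B_def)
    have fU: "f \<in> U" using fC \<eta>0 by (simp add: U_def)
    have close: "\<bar>g z - f z\<bar> \<le> 12 * card I * d + d" if g: "g \<in> U \<inter> S m" and z: "z \<in> topspace X" for g z
    proof -
      obtain c where c: "\<And>i. i \<in> I \<Longrightarrow> c i \<in> C i" "is_lub I c z" using gen[OF z] by blast
      have cD: "c i \<in> D i" if "i \<in> I" for i using c D that by blast
      define near where "near i b \<longleftrightarrow> b \<in> E i \<and> c i \<sqsubseteq> b \<and>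
          (\<forall>y\<in>topspace X. \<bar>f (c i \<squnion> y) - f (b \<squnion> y)\<bar> \<le> d) \<and>
          (\<forall>y\<in>topspace X. \<bar>g (c i \<squnion> y) - g (b \<squnion> y)\<bar> \<le> 6 * d)" for i b
      have "\<exists>b. near i b" if i: "i \<in> I" for i
      proof -
        have gP: "\<forall>p\<in>P i. \<bar>g p - f p\<bar> < \<eta> i"
          using i g \<eta>0(3)[OF i] by (force simp: U_def Q_def)
        have gl: "variation_bound (D i) d g (level f i)"
          using level[of g i] same[of g i] g i by (auto simp: S_def)
        from bspec[OF rigid[OF i] cD[OF i]] show ?thesis
        proof (elim bexE conjE)
          fix b assume b: "b \<in> E i" "c i \<sqsubseteq> b" "\<forall>y\<in>topspace X. \<bar>f (c i \<squnion> y) - f (b \<squnion> y)\<bar> \<le> d"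
            and G: "\<forall>g. (\<forall>p\<in>P i. \<bar>g p - f p\<bar> < \<eta> i) \<longrightarrow> variation_bound (D i) d g (level f i) \<longrightarrow>
              (\<forall>y\<in>topspace X. \<bar>g (c i \<squnion> y) - g (b \<squnion> y)\<bar> \<le> 6 * d)"
          show ?thesis
            unfolding near_def by (intro exI[of _ b] conjI b G[THEN spec, THEN mp, THEN mp, OF gP gl])
        qed
      qed
      then obtain b0 where b0: "\<And>i. i \<in> I \<Longrightarrow> near i (b0 i)" by metis
      define b where "b = restrict b0 I"
      have b: "b i \<in> E i" "c i \<sqsubseteq> b i" "\<And>y. y \<in> topspace X \<Longrightarrow> \<bar>f (c i \<squnion> y) - f (b i \<squnion> y)\<bar> \<le> d"
        "\<And>y. y \<in> topspace X \<Longrightarrow> \<bar>g (c i \<squnion> y) - g (b i \<squnion> y)\<bar> \<le> 6 * d" if "i \<in> I" for i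
        using b0[OF that] that by (auto simp: b_def near_def)
      have bX: "b i \<in> topspace X" "c i \<in> topspace X" if "i \<in> I" for i
        using b(1) P(5) D(4) cD that by blast+
      have "\<exists>t\<in>topspace X. z \<sqsubseteq> t \<and> (\<forall>j\<in>I. b j \<sqsubseteq> t) \<and>
        (\<forall>p\<in>topspace X. z \<sqsubseteq> p \<longrightarrow> (\<forall>j\<in>I. b j \<sqsubseteq> p) \<longrightarrow> t \<sqsubseteq> p) \<and> (\<forall>h\<in>{f, g}. \<bar>h z - h t\<bar> \<le> card I * (6 * d))"
      proof (rule replace_joinands[OF I z bX(2) bX(1)])
        show "c j \<sqsubseteq> z" if "j \<in> I" for j using that c(2) by (auto simp: is_lub_def)
        show "\<bar>h (c j \<squnion> y) - h (b j \<squnion> y)\<bar> \<le> 6 * d" if "h \<in> {f, g}" "j \<in> I" "y \<in> topspace X" for h j y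
          using b(3,4)[OF that(2,3)] that(1) d by auto
      qed
      then obtain t where t: "t \<in> topspace X" "z \<sqsubseteq> t" "\<forall>j\<in>I. b j \<sqsubseteq> t"
        "\<forall>p\<in>topspace X. z \<sqsubseteq> p \<longrightarrow> (\<forall>j\<in>I. b j \<sqsubseteq> p) \<longrightarrow> t \<sqsubseteq> p"
        and ft: "\<bar>f z - f t\<bar> \<le> card I * (6 * d)" "\<bar>g z - g t\<bar> \<le> card I * (6 * d)"
        by auto
      \<comment> \<open>Since \<open>c j \<sqsubseteq> b j\<close>, the point \<open>z\<close> itself can be omitted from the least upper bound \<open>t\<close>.\<close>
      have "z \<sqsubseteq> p" if "p \<in> topspace X" "\<forall>j\<in>I. b j \<sqsubseteq> p" for p
      proof -
        have "\<forall>j\<in>I. c j \<sqsubseteq> p" using that le_trans[OF bX(2) bX(1) that(1) b(2)] by blast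
        then show ?thesis using c(2) that(1) by (auto simp: is_lub_def)
      qed
      then have lub: "is_lub I b t" using t by (auto simp: is_lub_def)
      then have "(THE t. is_lub I b t) = t" by (rule the_equality) (rule is_lub_unique[OF _ lub])
      moreover have "b \<in> (\<Pi>\<^sub>E i\<in>I. E i)" using b(1) by (auto simp: b_def)
      ultimately have "t \<in> B" using t(1) by (force simp: B_def image_iff)
      then have "\<bar>g t - f t\<bar> < \<eta>0" using g by (auto simp: U_def Q_def)
      then have "\<bar>g t - f t\<bar> \<le> d" using \<eta>0(2) by linarith
      moreover have "real (12 * card I) * d = 2 * (card I * (6 * d))" by simp
      ultimately show ?thesis using ft by linarith
    qed
    have "mdiam (C_metric X) (U \<inter> S m) \<le> ennreal (2 * (12 * card I * d + d))"
    proof (rule mdiam_C_metric_le[OF compact ne])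
      show "U \<inter> S m \<subseteq> C_space X" by (auto simp: U_def)
    qed (rule close)
    also have "\<dots> < ennreal \<epsilon>" using d_\<epsilon> \<epsilon> by (intro ennreal_lessI)
    finally show ?thesis using U fU by blast
  qed
  ultimately show "\<exists>S :: nat \<Rightarrow> _. topspace (pointwise_topology X) = (\<Union>m. S m) \<and>
      (\<forall>m. \<forall>f\<in>S m. \<exists>U. openin (pointwise_topology X) U \<and> f \<in> U \<and> mdiam (C_metric X) (U \<inter> S m) < ennreal \<epsilon>)"
    by (intro exI[of _ S]) simp
qed

end

section \<open>Sublattices of products of compact lines\<close>

lemma openin_line_rays:
  assumes "a \<in> A"
  shows "openin (line_topology A r) {x \<in> A. (x, a) \<in> r \<and> x \<noteq> a}"
    and "openin (line_topology A r) {x \<in> A. (a, x) \<in> r \<and> x \<noteq> a}"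
  using assms unfolding line_topology_def by (auto intro!: topology_generated_by_Basis)

lemma linear_order_onD:
  assumes "linear_order_on A r"
  shows "x \<in> A \<Longrightarrow> (x, x) \<in> r" and "(x, y) \<in> r \<Longrightarrow> (y, z) \<in> r \<Longrightarrow> (x, z) \<in> r"
    and "(x, y) \<in> r \<Longrightarrow> (y, x) \<in> r \<Longrightarrow> x = y" and "x \<in> A \<Longrightarrow> y \<in> A \<Longrightarrow> (x, y) \<in> r \<or> (y, x) \<in> r"
proof -
  have r: "refl_on A r" "trans r" "antisym r" "total_on A r"
    using assms by (simp_all add: order_on_defs)
  show "(x, x) \<in> r" if "x \<in> A" using r(1) that by (rule refl_onD)
  show "(x, z) \<in> r" if "(x, y) \<in> r" "(y, z) \<in> r" using r(2) that by (rule transD)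
  show "x = y" if "(x, y) \<in> r" "(y, x) \<in> r" using r(3) that by (rule antisymD)
  show "(x, y) \<in> r \<or> (y, x) \<in> r" if "x \<in> A" "y \<in> A"
    using that r(1,4) by (cases "x = y") (simp_all add: refl_on_def total_on_def)
qed

text \<open>Two points are separated by rays starting at a point in between or, if they are adjacent, by the
  rays starting at the points themselves.\<close>

lemma Hausdorff_line_topology:
  assumes r: "linear_order_on A r"
  shows "Hausdorff_space (line_topology A r)"
proof -
  have sep: "\<exists>U V. openin (line_topology A r) U \<and> openin (line_topology A r) V \<and> x \<in> U \<and> y \<in> V \<and> disjnt U V"
    if xy: "x \<in> A" "y \<in> A" "(x, y) \<in> r" "x \<noteq> y" for x y
  proof (cases "\<exists>c\<in>A. (x, c) \<in> r \<and> (c, y) \<in> r \<and> c \<noteq> x \<and> c \<noteq> y")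
    case True
    then obtain c where c: "c \<in> A" "(x, c) \<in> r" "(c, y) \<in> r" "c \<noteq> x" "c \<noteq> y" by blast
    then show ?thesis
      using openin_line_rays[OF c(1), of r] xy linear_order_onD(3)[OF r]
      by (intro exI[of _ "{u \<in> A. (u, c) \<in> r \<and> u \<noteq> c}"] exI[of _ "{u \<in> A. (c, u) \<in> r \<and> u \<noteq> c}"])
        (auto simp: disjnt_iff)
  next
    case False
    then show ?thesis
      using openin_line_rays(1)[OF xy(2), of r] openin_line_rays(2)[OF xy(1), of r] xy linear_order_onD(3)[OF r]
      by (intro exI[of _ "{u \<in> A. (u, y) \<in> r \<and> u \<noteq> y}"] exI[of _ "{u \<in> A. (x, u) \<in> r \<and> u \<noteq> x}"])
        (auto simp: disjnt_iff)
  qed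
  show ?thesis
    unfolding Hausdorff_space_def topspace_line_topology
    by (metis sep linear_order_onD(4)[OF r] disjnt_sym)
qed

lemma line_max_rays:
  assumes r: "linear_order_on A r" and "x \<in> A" "y \<in> A" "a \<in> A"
  shows "(line_max r x y, a) \<in> r \<and> line_max r x y \<noteq> a \<longleftrightarrow> ((x, a) \<in> r \<and> x \<noteq> a) \<and> ((y, a) \<in> r \<and> y \<noteq> a)"
    and "(a, line_max r x y) \<in> r \<and> line_max r x y \<noteq> a \<longleftrightarrow> ((a, x) \<in> r \<and> x \<noteq> a) \<or> ((a, y) \<in> r \<and> y \<noteq> a)"
  unfolding line_max_def using assms linear_order_onD[OF r] by (auto; metis)+

lemma continuous_map_line_max:
  assumes r: "linear_order_on A r"
    and f: "continuous_map T (line_topology A r) f" and g: "continuous_map T (line_topology A r) g"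
  shows "continuous_map T (line_topology A r) (\<lambda>x. line_max r (f x) (g x))"
proof -
  have A: "f x \<in> A" "g x \<in> A" if "x \<in> topspace T" for x
    using continuous_map_image_subset_topspace[OF f] continuous_map_image_subset_topspace[OF g] that by auto
  have mx: "line_max r (f x) (g x) \<in> A" if "x \<in> topspace T" for x
    using A[OF that] by (simp add: line_max_def)
  have below: "openin T ((\<lambda>x. line_max r (f x) (g x)) -` {x \<in> A. (x, a) \<in> r \<and> x \<noteq> a} \<inter> topspace T)" if a: "a \<in> A" for a
  proof -
    have preimage: "(\<lambda>x. line_max r (f x) (g x)) -` {x \<in> A. (x, a) \<in> r \<and> x \<noteq> a} \<inter> topspace T =
       {x \<in> topspace T. f x \<in> {x \<in> A. (x, a) \<in> r \<and> x \<noteq> a}} \<inter> {x \<in> topspace T. g x \<in> {x \<in> A. (x, a) \<in> r \<and> x \<noteq> a}}"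
      (is "?M = ?R")
    proof (rule set_eqI)
      fix x
      have "x \<in> ?M \<longleftrightarrow> x \<in> topspace T \<and> ((line_max r (f x) (g x), a) \<in> r \<and> line_max r (f x) (g x) \<noteq> a)"
        using mx by auto
      also have "\<dots> \<longleftrightarrow> x \<in> topspace T \<and> (((f x, a) \<in> r \<and> f x \<noteq> a) \<and> ((g x, a) \<in> r \<and> g x \<noteq> a))"
        using line_max_rays(1)[OF r A(1) A(2) a, of x x] by (rule conj_cong[OF refl])
      also have "\<dots> \<longleftrightarrow> x \<in> ?R"
        using A by auto
      finally show "x \<in> ?M \<longleftrightarrow> x \<in> ?R" .
    qed
    show ?thesis
      unfolding preimage
      by (intro openin_Int openin_continuous_map_preimage[OF f] openin_continuous_map_preimage[OF g]
          openin_line_rays(1)[OF a])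
  qed
  have above: "openin T ((\<lambda>x. line_max r (f x) (g x)) -` {x \<in> A. (a, x) \<in> r \<and> x \<noteq> a} \<inter> topspace T)" if a: "a \<in> A" for a
  proof -
    have preimage: "(\<lambda>x. line_max r (f x) (g x)) -` {x \<in> A. (a, x) \<in> r \<and> x \<noteq> a} \<inter> topspace T =
       {x \<in> topspace T. f x \<in> {x \<in> A. (a, x) \<in> r \<and> x \<noteq> a}} \<union> {x \<in> topspace T. g x \<in> {x \<in> A. (a, x) \<in> r \<and> x \<noteq> a}}"
      (is "?M = ?R")
    proof (rule set_eqI)
      fix x
      have "x \<in> ?M \<longleftrightarrow> x \<in> topspace T \<and> ((a, line_max r (f x) (g x)) \<in> r \<and> line_max r (f x) (g x) \<noteq> a)"
        using mx by auto
      also have "\<dots> \<longleftrightarrow> x \<in> topspace T \<and> (((a, f x) \<in> r \<and> f x \<noteq> a) \<or> ((a, g x) \<in> r \<and> g x \<noteq> a))"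
        using line_max_rays(2)[OF r A(1) A(2) a, of x x] by (rule conj_cong[OF refl])
      also have "\<dots> \<longleftrightarrow> x \<in> ?R"
        using A by auto
      finally show "x \<in> ?M \<longleftrightarrow> x \<in> ?R" .
    qed
    show ?thesis
      unfolding preimage
      by (intro openin_Un openin_continuous_map_preimage[OF f] openin_continuous_map_preimage[OF g]
          openin_line_rays(2)[OF a])
  qed
  have "(\<lambda>x. line_max r (f x) (g x)) -` A \<inter> topspace T = topspace T"
    using mx by blast
  then have whole: "openin T ((\<lambda>x. line_max r (f x) (g x)) -` A \<inter> topspace T)" by simp
  show ?thesis
    unfolding line_topology_def
  proof (rule continuous_on_generated_topo)
    show "(\<lambda>x. line_max r (f x) (g x)) ` topspace T \<subseteq> \<Union> ({A} \<union>
        {{x \<in> A. (x, a) \<in> r \<and> x \<noteq> a} |a. a \<in> A} \<union> {{x \<in> A. (a, x) \<in> r \<and> x \<noteq> a} |a. a \<in> A})"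
      using mx by blast
  qed (use whole below above in blast)
qed

lemma line_max_semilattice:
  assumes r: "linear_order_on A r" and "x \<in> A" "y \<in> A"
  shows "line_max r x x = x" "line_max r x y = line_max r y x" "line_max r x y \<in> A"
    "line_max r (line_max r x y) z = line_max r x (line_max r y z)"
    "line_max r x y = y \<longleftrightarrow> (x, y) \<in> r"
proof -
  have tot: "(x, y) \<in> r \<or> (y, x) \<in> r" and refl: "(x, x) \<in> r"
    using assms linear_order_onD(1,4)[OF r] by blast+
  note anti = linear_order_onD(3)[OF r, of x y]
  show "line_max r x x = x" "line_max r x y \<in> A"
    using assms by (simp_all add: line_max_def)
  show "line_max r x y = line_max r y x" "line_max r x y = y \<longleftrightarrow> (x, y) \<in> r"
    using tot refl anti by (auto simp: line_max_def)
  show "line_max r (line_max r x y) z = line_max r x (line_max r y z)"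
    using tot linear_order_onD(2)[OF r, of x y z] linear_order_onD(2)[OF r, of y x z]
    by (auto simp: line_max_def)
qed

definition prod_join :: "'i set \<Rightarrow> ('i \<Rightarrow> 'a rel) \<Rightarrow> ('i \<Rightarrow> 'a) \<Rightarrow> ('i \<Rightarrow> 'a) \<Rightarrow> 'i \<Rightarrow> 'a" where
  "prod_join I r p q = (\<lambda>i\<in>I. line_max (r i) (p i) (q i))"

lemma compact_semilattice_prod_sublattice:
  fixes I :: "'i set"
  assumes L: "\<And>i. i \<in> I \<Longrightarrow> compact_line (L i) (r i)"
    and K: "prod_sublattice I L r K" and closed: "closedin (lines_product_topology I L r) K"
  shows "compact_semilattice (subtopology (lines_product_topology I L r) K) (prod_join I r)"
proof -
  let ?P = "lines_product_topology I L r"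
  let ?X = "subtopology ?P K"
  have lin: "linear_order_on (L i) (r i)" and comp: "compact_space (line_topology (L i) (r i))" if "i \<in> I" for i
    using L[OF that] by (auto simp: compact_line_def)
  have KL: "K \<subseteq> (\<Pi>\<^sub>E i\<in>I. L i)" using K by (auto simp: prod_sublattice_def)
  have top: "topspace ?X = K" using KL by (auto simp: lines_product_topology_def)
  have coord: "p i \<in> L i" if "p \<in> K" "i \<in> I" for p i using that KL by blast
  have ext: "p \<in> extensional I" if "p \<in> K" for p using that KL by (auto simp: PiE_def)
  have proj: "continuous_map ?X (line_topology (L i) (r i)) (\<lambda>p. p i)" if "i \<in> I" for i
    unfolding lines_product_topology_def
    by (intro continuous_map_from_subtopology continuous_map_product_projection that)
  show ?thesis
  proof
    have "compact_space ?P"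
      unfolding lines_product_topology_def compact_space_product_topology using comp by blast
    then show "compact_space ?X"
      using closed closedin_compact_space compact_space_subtopology by blast
    have "Hausdorff_space ?P"
      unfolding lines_product_topology_def Hausdorff_space_product_topology
      using Hausdorff_line_topology[OF lin] by blast
    then show "Hausdorff_space ?X" by (rule Hausdorff_space_subtopology)
    have "continuous_map (prod_topology ?X ?X) (line_topology (L i) (r i)) (\<lambda>p. line_max (r i) (fst p i) (snd p i))"
      if i: "i \<in> I" for i
      using continuous_map_compose[OF continuous_map_fst proj[OF i]]
        continuous_map_compose[OF continuous_map_snd proj[OF i]]
      by (intro continuous_map_line_max[OF lin[OF i]]) (simp_all add: o_def)
    then have "continuous_map (prod_topology ?X ?X) ?P (\<lambda>p. prod_join I r (fst p) (snd p))"
      unfolding lines_product_topology_def prod_join_def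
      by (simp add: continuous_map_componentwise restrict_def image_subset_iff extensional_def)
    moreover have "prod_join I r p q \<in> K" if "p \<in> K" "q \<in> K" for p q
      using K that by (auto simp: prod_sublattice_def prod_join_def)
    ultimately show "continuous_map (prod_topology ?X ?X) ?X (\<lambda>(p, q). prod_join I r p q)"
      unfolding case_prod_beta continuous_map_in_subtopology topspace_prod_topology top by auto
  next
    show "prod_join I r (prod_join I r x y) z = prod_join I r x (prod_join I r y z)"
      if "x \<in> topspace ?X" "y \<in> topspace ?X" "z \<in> topspace ?X" for x y z
      using that line_max_semilattice(4)[OF lin coord coord]
      unfolding top prod_join_def by (auto intro!: restrict_ext)
    show "prod_join I r x y = prod_join I r y x" if "x \<in> topspace ?X" "y \<in> topspace ?X" for x y
      using that line_max_semilattice(2)[OF lin coord coord]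
      unfolding top prod_join_def by (auto intro!: restrict_ext)
    show "prod_join I r x x = x" if "x \<in> topspace ?X" for x
    proof
      have x: "x \<in> K" using that top by simp
      show "prod_join I r x x i = x i" for i
        using line_max_semilattice(1)[OF lin coord[OF x] coord[OF x]] extensional_arb[OF ext[OF x]]
        by (cases "i \<in> I") (auto simp: prod_join_def)
    qed
  qed
qed

text \<open>For \<open>z \<in> K\<close> and each coordinate \<open>i\<close>, the points of \<open>K\<close> whose \<open>i\<close>-th coordinate is at least \<open>z i\<close> form a
  compact set closed under meets, which therefore has a least element. The least elements obtained in
  this way for one fixed \<open>i\<close> form a chain, and \<open>z\<close> is the least upper bound of those belonging to it, so
  \<open>K\<close> is generated under joins by one chain per coordinate.\<close>

theorem SLD_prod_sublattice:
  fixes I :: "'i set"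
  assumes I: "finite I" and L: "\<And>i. i \<in> I \<Longrightarrow> compact_line (L i) (r i)"
    and K: "prod_sublattice I L r K" and closed: "closedin (lines_product_topology I L r) K"
  shows "SLD (pointwise_topology (subtopology (lines_product_topology I L r) K))
             (C_metric (subtopology (lines_product_topology I L r) K))"
proof -
  define X where "X = subtopology (lines_product_topology I L r) K"
  interpret compact_semilattice X "prod_join I r"
    unfolding X_def by (rule compact_semilattice_prod_sublattice[OF L K closed])
  have lin: "linear_order_on (L i) (r i)" if "i \<in> I" for i
    using L[OF that] by (auto simp: compact_line_def)
  have KL: "K \<noteq> {}" "K \<subseteq> (\<Pi>\<^sub>E i\<in>I. L i)" using K by (auto simp: prod_sublattice_def)
  have top: "topspace X = K" using KL by (auto simp: X_def lines_product_topology_def)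
  have coord: "p i \<in> L i" if "p \<in> K" "i \<in> I" for p i using that KL by blast
  have ext: "p \<in> extensional I" if "p \<in> K" for p using that KL by (auto simp: PiE_def)
  have le_iff: "le p q \<longleftrightarrow> (\<forall>i\<in>I. (p i, q i) \<in> r i)" if "p \<in> K" "q \<in> K" for p q
  proof -
    have "le p q \<longleftrightarrow> (\<forall>i\<in>I. line_max (r i) (p i) (q i) = q i)"
      using ext[OF that(2)] unfolding le_def prod_join_def by (auto simp: fun_eq_iff extensional_def)
    then show ?thesis using line_max_semilattice(5)[OF lin coord coord] that by blast
  qed
  \<comment> \<open>All those least elements for the coordinate \<open>i\<close>, described without reference to a point \<open>z\<close>: the
    bound on the \<open>i\<close>-th coordinate can be taken to be the coordinate of the least element itself.\<close>
  define C where "C i = {u \<in> K. \<forall>p\<in>K. (u i, p i) \<in> r i \<longrightarrow> le u p}" for i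
  have chain: "chain_in (C i)" if i: "i \<in> I" for i
    using linear_order_onD(4)[OF lin[OF i] coord coord] i by (auto simp: chain_in_def C_def top)
  have ex: "\<exists>c\<in>C i. (z i, c i) \<in> r i \<and> le c z" if z: "z \<in> K" and i: "i \<in> I" for z i
  proof -
    define T where "T = {p \<in> K. (z i, p i) \<in> r i}"
    have "closedin (line_topology (L i) (r i)) {x \<in> L i. (z i, x) \<in> r i}"
    proof -
      have "{x \<in> L i. (z i, x) \<in> r i} = topspace (line_topology (L i) (r i)) - {x \<in> L i. (x, z i) \<in> r i \<and> x \<noteq> z i}"
        using linear_order_onD(1,4)[OF lin[OF i] coord[OF z i]] linear_order_onD(3)[OF lin[OF i]] by auto
      then show ?thesis
        by (simp only:) (intro closedin_diff closedin_topspace openin_line_rays(1) coord[OF z i])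
    qed
    moreover have "continuous_map X (line_topology (L i) (r i)) (\<lambda>p. p i)"
      unfolding X_def lines_product_topology_def
      by (intro continuous_map_from_subtopology continuous_map_product_projection i)
    ultimately have "closedin X {p \<in> topspace X. p i \<in> {x \<in> L i. (z i, x) \<in> r i}}"
      by (rule closedin_continuous_map_preimage[rotated])
    moreover have "{p \<in> topspace X. p i \<in> {x \<in> L i. (z i, x) \<in> r i}} = T"
      using coord i by (auto simp: T_def top)
    ultimately have T: "compactin X T" using closedin_compact_space[OF compact] by simp
    have "\<exists>m\<in>T. \<forall>q\<in>T. le m q"
    proof (rule compact_directed_has_least[OF T])
      show "T \<noteq> {}" using z linear_order_onD(1)[OF lin[OF i] coord[OF z i]] by (auto simp: T_def)
      show "closedin X {p \<in> topspace X. le p q}" if "q \<in> T" for q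
        using that closedin_below by (simp add: T_def top)
      show "le p s" if "p \<in> T" "q \<in> T" "s \<in> T" "le p q" "le q s" for p q s
        using that le_trans[of p q s] by (simp add: T_def top)
      show "\<exists>m\<in>T. le m p \<and> le m q" if pq: "p \<in> T" "q \<in> T" for p q
      proof
        define m where "m = (\<lambda>i\<in>I. line_min (r i) (p i) (q i))"
        have pqK: "p \<in> K" "q \<in> K" using pq by (auto simp: T_def)
        then have mK: "m \<in> K" using K by (auto simp: prod_sublattice_def m_def)
        show "m \<in> T" using pq mK i by (auto simp: T_def m_def line_min_def)
        have "(m j, p j) \<in> r j \<and> (m j, q j) \<in> r j" if "j \<in> I" for j
          using linear_order_onD(1)[OF lin[OF that] coord[OF pqK(1) that]] that
            linear_order_onD(1)[OF lin[OF that] coord[OF pqK(2) that]]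
            linear_order_onD(4)[OF lin[OF that] coord[OF pqK(1) that] coord[OF pqK(2) that]]
          by (auto simp: m_def line_min_def)
        then show "le m p \<and> le m q" using le_iff mK pqK by blast
      qed
    qed
    then obtain m where m: "m \<in> T" "\<forall>q\<in>T. le m q" by blast
    have "m \<in> C i"
      using m linear_order_onD(2)[OF lin[OF i], of "z i" "m i"] by (auto simp: C_def T_def)
    moreover have "le m z"
      using m(2) z linear_order_onD(1)[OF lin[OF i] coord[OF z i]] by (simp add: T_def)
    ultimately show ?thesis using m(1) by (auto simp: T_def)
  qed
  have "SLD (pointwise_topology X) (C_metric X)"
  proof (rule SLD_if_join_generated_by_chains[OF I _ chain])
    show "topspace X \<noteq> {}" using KL top by simp
    show "\<exists>c. (\<forall>i\<in>I. c i \<in> C i) \<and> is_lub I c z" if "z \<in> topspace X" for z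
    proof -
      have z: "z \<in> K" using that top by simp
      obtain c where c: "\<And>i. i \<in> I \<Longrightarrow> c i \<in> C i" "\<And>i. i \<in> I \<Longrightarrow> (z i, c i i) \<in> r i" "\<And>i. i \<in> I \<Longrightarrow> le (c i) z"
        using ex[OF z] by metis
      have "le z p" if p: "p \<in> K" "\<forall>i\<in>I. le (c i) p" for p
      proof -
        have "(z i, p i) \<in> r i" if i: "i \<in> I" for i
        proof -
          have "c i \<in> K" using c(1)[OF i] by (simp add: C_def)
          then have "(c i i, p i) \<in> r i" using le_iff p i by blast
          then show ?thesis by (rule linear_order_onD(2)[OF lin[OF i] c(2)[OF i]])
        qed
        then show ?thesis using le_iff z p by blast
      qed
      then show ?thesis using c(1,3) z by (intro exI[of _ c]) (simp add: is_lub_def top)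
    qed
  qed
  then show ?thesis by (simp add: X_def)
qed

theorem theorem4p1:
  fixes n :: nat and L :: "nat \<Rightarrow> 'a set" and r :: "nat \<Rightarrow> 'a rel" and K :: "(nat \<Rightarrow> 'a) set"
  assumes "n \<ge> 1"
    and "\<And>i. i \<in> {1..n} \<Longrightarrow> compact_line (L i) (r i)"
    and "prod_sublattice {1..n} L r K"
    and "closedin (lines_product_topology {1..n} L r) K"
  shows "SLD (pointwise_topology (subtopology (lines_product_topology {1..n} L r) K))
             (C_metric (subtopology (lines_product_topology {1..n} L r) K))"
  by (rule SLD_prod_sublattice[OF finite_atLeastAtMost assms(2-4)])

end
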